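(* Let $k$ be a field and let $\mathcal{C}$ be a finite deterministic cancellative category. Then there is a surjective morphism of graded $k$-vector spaces $\mathcal{T}^{\bullet}:\mathrm{HH}^{\bullet}(k\mathcal{C})\rightarrow \mathrm{H}^{\bullet}(F^{\mathrm{ad}}(\mathcal{C}),k)$ from the Hochschild cohomology of the category algebra $k\mathcal{C}$ to the simplicial cohomology of the category $F^{\mathrm{ad}}(\mathcal{C})$. Moreover, if $\mathcal{C}$ is rr-transitive, then $\mathcal{T}^{\bullet}$ is an isomorphism.
   Context: A category is finite if it has finitely many objects and all its sets of morphisms are finite. For a morphism $a$, $s(a)$ and $t(a)$ are its source and target. The category algebra $k\mathcal{C}$ is the $k$-vector space with basis $\mathrm{Mor}(\mathcal{C})$ and product $ab=a\circ b$ if $s(a)=t(b)$, and $ab=0$ otherwise. $\mathrm{HH}^{\bullet}(k\mathcal{C})$ is the usual Hochschild cohomology of the $k$-algebra $k\mathcal{C}$ with coefficients in itself. $\mathcal{C}$ is left deterministic if for all $g\in\mathrm{Hom}_{\mathcal{C}}(x_1,x_2)$ and $b\in\mathrm{End}_{\mathcal{C}}(x_2)$ there is $a\in\mathrm{End}_{\mathcal{C}}(x_1)$ with $g\circ a=b\circ g$; right deterministic if for all $g\in\mathrm{Hom}_{\mathcal{C}}(x_1,x_2)$ and $a\in\mathrm{End}_{\mathcal{C}}(x_1)$ there is $b\in\mathrm{End}_{\mathcal{C}}(x_2)$ with $g\circ a=b\circ g$; deterministic if both. $\mathcal{C}$ is left (right) cancellative if composition of morphisms is left (right) cancellable, and cancellative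 if both. $\mathcal{C}$ is rr-transitive if for all objects $x_1,x_2$ the right action of the monoid $\mathrm{End}_{\mathcal{C}}(x_1)$ on $\mathrm{Hom}_{\mathcal{C}}(x_1,x_2)$ by composition, $(g,a)\mapsto g\circ a$, is transitive, i.e. for all $f,g\in\mathrm{Hom}_{\mathcal{C}}(x_1,x_2)$ there is $a\in\mathrm{End}_{\mathcal{C}}(x_1)$ with $g\circ a=f$. The adjoint category $F^{\mathrm{ad}}(\mathcal{C})$ has as objects all endomorphisms in $\mathcal{C}$; a morphism from $a\in\mathrm{End}_{\mathcal{C}}(x_1)$ to $b\in\mathrm{End}_{\mathcal{C}}(x_2)$ is a $g\in\mathrm{Hom}_{\mathcal{C}}(x_1,x_2)$ with $g\circ a=b\circ g$; composition is that of $\mathcal{C}$. For a small category $\mathcal{D}$, $\mathrm{H}^{\bullet}(\mathcal{D},k)$ is the cohomology of the nerve of $\mathcal{D}$ with coefficients in $k$: let $N\mathcal{D}_m$ be the set of chains $a_0\xrightarrow{g_0}a_1\to\cdots\xrightarrow{g_{m-1}}a_m$ of $m$ composable morphisms ($N\mathcal{D}_0=\mathrm{Ob}(\mathcal{D})$), let $C^m=\mathrm{Hom}_k(kN\mathcal{D}_m,k)$, and $\delta^m(f)=\sum_{i=0}^{m+1}(-1)^i f\circ d_i^m$, where $d_i^m:N\mathcal{D}_{m+1}\to N\mathcal{D}_m$ drops $a_0$ (and $g_0$) if $i=0$, drops $a_{m+1}$ (and $g_m$) if $i=m+1$, and composes at $a_i$ (replacing $g_{i-1},g_i$ by $g_i\circ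 g_{i-1}$) if $1\le i\le m$. *)

theory Defs
  imports "HOL-Library.Poly_Mapping" "HOL-Library.Function_Algebras"
begin

section \<open>Categories\<close>

record ('o, 'm) cat =
  Obj :: "'o set"
  Mor :: "'m set"
  Src :: "'m \<Rightarrow> 'o"
  Tgt :: "'m \<Rightarrow> 'o"
  Idm :: "'o \<Rightarrow> 'm"
  Cmp :: "'m \<Rightarrow> 'm \<Rightarrow> 'm"

text \<open>\<open>Cmp C g f\<close> is \<open>g \<circ> f\<close> (first \<open>f\<close>, then \<open>g\<close>); its value is irrelevant
  unless \<open>Src C g = Tgt C f\<close>.\<close>

definition Hom :: "('o, 'm, 'z) cat_scheme \<Rightarrow> 'o \<Rightarrow> 'o \<Rightarrow> 'm set" where
  "Hom C x y = {f \<in> Mor C. Src C f = x \<and> Tgt C f = y}"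

abbreviation End :: "('o, 'm, 'z) cat_scheme \<Rightarrow> 'o \<Rightarrow> 'm set" where
  "End C x \<equiv> Hom C x x"

locale category =
  fixes C :: "('o, 'm) cat"
  assumes Src_in_Obj: "f \<in> Mor C \<Longrightarrow> Src C f \<in> Obj C"
    and Tgt_in_Obj: "f \<in> Mor C \<Longrightarrow> Tgt C f \<in> Obj C"
    and Idm_in_End: "x \<in> Obj C \<Longrightarrow> Idm C x \<in> End C x"
    and Cmp_in_Hom: "f \<in> Hom C x y \<Longrightarrow> g \<in> Hom C y z \<Longrightarrow> Cmp C g f \<in> Hom C x z"
    and Cmp_Idm_right: "f \<in> Hom C x y \<Longrightarrow> Cmp C f (Idm C x) = f"
    and Cmp_Idm_left: "f \<in> Hom C x y \<Longrightarrow> Cmp C (Idm C y) f = f"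
    and Cmp_assoc: "f \<in> Hom C w x \<Longrightarrow> g \<in> Hom C x y \<Longrightarrow> h \<in> Hom C y z
      \<Longrightarrow> Cmp C h (Cmp C g f) = Cmp C (Cmp C h g) f"

locale finite_category = category +
  assumes finite_Obj: "finite (Obj C)"
    and finite_Hom: "x \<in> Obj C \<Longrightarrow> y \<in> Obj C \<Longrightarrow> finite (Hom C x y)"

definition left_deterministic :: "('o, 'm) cat \<Rightarrow> bool" where
  "left_deterministic C \<longleftrightarrow>
    (\<forall>x1 \<in> Obj C. \<forall>x2 \<in> Obj C. \<forall>g \<in> Hom C x1 x2. \<forall>b \<in> End C x2.
      \<exists>a \<in> End C x1. Cmp C g a = Cmp C b g)"

definition right_deterministic :: "('o, 'm) cat \<Rightarrow> bool" where
  "right_deterministic C \<longleftrightarrow>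
    (\<forall>x1 \<in> Obj C. \<forall>x2 \<in> Obj C. \<forall>g \<in> Hom C x1 x2. \<forall>a \<in> End C x1.
      \<exists>b \<in> End C x2. Cmp C g a = Cmp C b g)"

definition deterministic :: "('o, 'm) cat \<Rightarrow> bool" where
  "deterministic C \<longleftrightarrow> left_deterministic C \<and> right_deterministic C"

definition left_cancellative :: "('o, 'm) cat \<Rightarrow> bool" where
  "left_cancellative C \<longleftrightarrow>
    (\<forall>x \<in> Obj C. \<forall>y \<in> Obj C. \<forall>z \<in> Obj C.
      \<forall>g \<in> Hom C y z. \<forall>f \<in> Hom C x y. \<forall>f' \<in> Hom C x y.
      Cmp C g f = Cmp C g f' \<longrightarrow> f = f')"

definition right_cancellative :: "('o, 'm) cat \<Rightarrow> bool" where
  "right_cancellative C \<longleftrightarrow>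
    (\<forall>x \<in> Obj C. \<forall>y \<in> Obj C. \<forall>z \<in> Obj C.
      \<forall>f \<in> Hom C x y. \<forall>g \<in> Hom C y z. \<forall>g' \<in> Hom C y z.
      Cmp C g f = Cmp C g' f \<longrightarrow> g = g')"

definition cancellative :: "('o, 'm) cat \<Rightarrow> bool" where
  "cancellative C \<longleftrightarrow> left_cancellative C \<and> right_cancellative C"

definition rr_transitive :: "('o, 'm) cat \<Rightarrow> bool" where
  "rr_transitive C \<longleftrightarrow>
    (\<forall>x1 \<in> Obj C. \<forall>x2 \<in> Obj C. \<forall>f \<in> Hom C x1 x2. \<forall>g \<in> Hom C x1 x2.
      \<exists>a \<in> End C x1. Cmp C g a = f)"

text \<open>The same \<open>g\<close> can be a morphism between several pairs of endomorphisms, so a morphism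
  \<open>a \<rightarrow> b\<close> of the adjoint category is recorded as the triple \<open>(a, g, b)\<close>.\<close>

definition adjoint_category :: "('o, 'm) cat \<Rightarrow> ('m, 'm \<times> 'm \<times> 'm) cat" where
  "adjoint_category C =
    \<lparr> Obj = (\<Union>x \<in> Obj C. End C x),
      Mor = {(a, g, b). \<exists>x1 \<in> Obj C. \<exists>x2 \<in> Obj C.
               a \<in> End C x1 \<and> b \<in> End C x2 \<and> g \<in> Hom C x1 x2 \<and> Cmp C g a = Cmp C b g},
      Src = (\<lambda>(a, g, b). a),
      Tgt = (\<lambda>(a, g, b). b),
      Idm = (\<lambda>a. (a, Idm C (Src C a), a)),
      Cmp = (\<lambda>(b, h, c) (a, g, b'). (a, Cmp C h g, c)) \<rparr>"

lemma mem_Hom_adjoint_category: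
  "f \<in> Hom (adjoint_category C) a b \<longleftrightarrow>
    (\<exists>x1 \<in> Obj C. \<exists>x2 \<in> Obj C. \<exists>g \<in> Hom C x1 x2.
      a \<in> End C x1 \<and> b \<in> End C x2 \<and> Cmp C g a = Cmp C b g \<and> f = (a, g, b))"
proof -
  have "f \<in> Hom (adjoint_category C) a b \<longleftrightarrow>
    f \<in> Mor (adjoint_category C) \<and> Src (adjoint_category C) f = a \<and> Tgt (adjoint_category C) f = b"
    by (simp add: Hom_def)
  then show ?thesis
    by (auto simp: adjoint_category_def)
qed

lemma category_adjoint_category:
  assumes "category C"
  shows "category (adjoint_category C)"
proof -
  interpret category C by fact
  let ?F = "adjoint_category C"
  have Mor_F: "f \<in> Mor ?F \<longleftrightarrow> f \<in> Hom ?F (Src ?F f) (Tgt ?F f)" for f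
    by (simp add: Hom_def)
  show ?thesis
  proof
    fix f assume "f \<in> Mor ?F"
    then show "Src ?F f \<in> Obj ?F" "Tgt ?F f \<in> Obj ?F"
      unfolding Mor_F mem_Hom_adjoint_category by (auto simp: adjoint_category_def)
  next
    fix a assume "a \<in> Obj ?F"
    then obtain x where x: "x \<in> Obj C" "a \<in> End C x"
      by (auto simp: adjoint_category_def)
    moreover have "Src C a = x"
      using x by (simp add: Hom_def)
    ultimately show "Idm ?F a \<in> End ?F a"
      unfolding mem_Hom_adjoint_category
      by (auto simp: adjoint_category_def Idm_in_End Cmp_Idm_right Cmp_Idm_left intro!: bexI [of _ x])
  next
    fix f a b g c assume "f \<in> Hom ?F a b" "g \<in> Hom ?F b c"
    then obtain u v p q q' r where u: "f = (a, u, b)" "p \<in> Obj C" "a \<in> End C p" "b \<in> End C q"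
        "u \<in> Hom C p q" "Cmp C u a = Cmp C b u"
      and v: "g = (b, v, c)" "r \<in> Obj C" "b \<in> End C q'" "c \<in> End C r" "v \<in> Hom C q' r"
        "Cmp C v b = Cmp C c v"
      unfolding mem_Hom_adjoint_category by blast
    have "q' = q"
      using u v by (auto simp: Hom_def)
    then have v': "v \<in> Hom C q r"
      using v by simp
    have "Cmp C (Cmp C v u) a = Cmp C v (Cmp C u a)"
      using Cmp_assoc [OF u(3,5) v'] by simp
    also have "\<dots> = Cmp C (Cmp C v b) u"
      using Cmp_assoc [OF u(5,4) v'] u(6) by simp
    also have "\<dots> = Cmp C c (Cmp C v u)"
      using Cmp_assoc [OF u(5) v' v(4)] v(6) by simp
    finally show "Cmp ?F g f \<in> Hom ?F a c"
      unfolding mem_Hom_adjoint_category u(1) v(1)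
      using u(2,3) v(2,4) Cmp_in_Hom [OF u(5) v'] by (auto simp: adjoint_category_def)
  next
    fix f a b assume "f \<in> Hom ?F a b"
    then obtain g p q where g: "f = (a, g, b)" "g \<in> Hom C p q" "a \<in> End C p" "b \<in> End C q"
      unfolding mem_Hom_adjoint_category by blast
    then have "Src C a = p" "Src C b = q"
      by (simp_all add: Hom_def)
    then show "Cmp ?F f (Idm ?F a) = f" "Cmp ?F (Idm ?F b) f = f"
      using g by (simp_all add: adjoint_category_def Cmp_Idm_left Cmp_Idm_right)
  next
    fix f a b g c h d assume "f \<in> Hom ?F a b" "g \<in> Hom ?F b c" "h \<in> Hom ?F c d"
    then obtain u v w p q q' r r' s
      where f: "f = (a, u, b)" "u \<in> Hom C p q" "b \<in> End C q"
        and g: "g = (b, v, c)" "v \<in> Hom C q' r" "b \<in> End C q'" "c \<in> End C r"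
        and h: "h = (c, w, d)" "w \<in> Hom C r' s" "c \<in> End C r'"
      unfolding mem_Hom_adjoint_category by blast
    have "q' = q" "r' = r"
      using f g h by (auto simp: Hom_def)
    then have "Cmp C w (Cmp C v u) = Cmp C (Cmp C w v) u"
      using Cmp_assoc f g h by blast
    then show "Cmp ?F h (Cmp ?F g f) = Cmp ?F (Cmp ?F h g) f"
      by (simp add: f(1) g(1) h(1) adjoint_category_def)
  qed
qed


section \<open>Linear algebra\<close>

text \<open>Vector spaces with explicit carrier; used for cohomology, whose elements are cosets.\<close>

record ('k, 'v) vspace =
  vcarrier :: "'v set"
  vadd :: "'v \<Rightarrow> 'v \<Rightarrow> 'v"
  vscale :: "'k \<Rightarrow> 'v \<Rightarrow> 'v"

definition vlinear :: "('k, 'v) vspace \<Rightarrow> ('k, 'w) vspace \<Rightarrow> ('v \<Rightarrow> 'w) \<Rightarrow> bool" where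
  "vlinear V W T \<longleftrightarrow>
    (\<forall>x \<in> vcarrier V. T x \<in> vcarrier W) \<and>
    (\<forall>x \<in> vcarrier V. \<forall>y \<in> vcarrier V. T (vadd V x y) = vadd W (T x) (T y)) \<and>
    (\<forall>c. \<forall>x \<in> vcarrier V. T (vscale V c x) = vscale W c (T x))"

definition linear_between ::
  "('k \<Rightarrow> 'v \<Rightarrow> 'v) \<Rightarrow> 'v::plus set \<Rightarrow> ('k \<Rightarrow> 'w \<Rightarrow> 'w) \<Rightarrow> 'w::plus set \<Rightarrow> ('v \<Rightarrow> 'w) \<Rightarrow> bool" where
  "linear_between s V t W f \<longleftrightarrow>
    (\<forall>x \<in> V. f x \<in> W) \<and>
    (\<forall>x \<in> V. \<forall>y \<in> V. f (x + y) = f x + f y) \<and>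
    (\<forall>c. \<forall>x \<in> V. f (s c x) = t c (f x))"

text \<open>The vector space \<open>kX\<close> with basis \<open>X\<close>, its scalar multiplication, and the linear map
  induced by a map of bases.\<close>

definition free_space :: "'x set \<Rightarrow> ('x \<Rightarrow>\<^sub>0 'k::field) set" where
  "free_space X = {u. Poly_Mapping.keys u \<subseteq> X}"

definition free_scale :: "'k \<Rightarrow> ('x \<Rightarrow>\<^sub>0 'k::field) \<Rightarrow> ('x \<Rightarrow>\<^sub>0 'k)" where
  "free_scale c u = Poly_Mapping.map (\<lambda>a. c * a) u"

definition free_map :: "('x \<Rightarrow> 'y) \<Rightarrow> ('x \<Rightarrow>\<^sub>0 'k::field) \<Rightarrow> ('y \<Rightarrow>\<^sub>0 'k)" where
  "free_map h u = (\<Sum>x \<in> Poly_Mapping.keys u. Poly_Mapping.single (h x) (Poly_Mapping.lookup u x))"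

text \<open>Cohomology of a cochain complex \<open>(Z n, d n)\<close> of subspaces of an ambient group with scalar
  multiplication \<open>s\<close>: the quotient of \<open>ker (d n)\<close> by the image of \<open>d (n - 1)\<close>
  (by \<open>0\<close> if \<open>n = 0\<close>).\<close>

definition cocycles :: "(nat \<Rightarrow> 'v::ab_group_add set) \<Rightarrow> (nat \<Rightarrow> 'v \<Rightarrow> 'v) \<Rightarrow> nat \<Rightarrow> 'v set" where
  "cocycles Z d n = {f \<in> Z n. d n f = 0}"

fun coboundaries :: "(nat \<Rightarrow> 'v::ab_group_add set) \<Rightarrow> (nat \<Rightarrow> 'v \<Rightarrow> 'v) \<Rightarrow> nat \<Rightarrow> 'v set" where
  "coboundaries Z d 0 = {0}"
| "coboundaries Z d (Suc n) = d n ` Z n"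

definition quotient_space :: "('k \<Rightarrow> 'v \<Rightarrow> 'v) \<Rightarrow> 'v::ab_group_add set \<Rightarrow> 'v set \<Rightarrow> ('k, 'v set) vspace"
  where
  "quotient_space s V B =
    \<lparr> vcarrier = {{v + b |b. b \<in> B} |v. v \<in> V},
      vadd = (\<lambda>X Y. {x + y |x y. x \<in> X \<and> y \<in> Y}),
      vscale = (\<lambda>c X. {s c x + b |x b. x \<in> X \<and> b \<in> B}) \<rparr>"

definition cohomology ::
  "('k \<Rightarrow> 'v \<Rightarrow> 'v) \<Rightarrow> (nat \<Rightarrow> 'v::ab_group_add set) \<Rightarrow> (nat \<Rightarrow> 'v \<Rightarrow> 'v) \<Rightarrow> nat \<Rightarrow> ('k, 'v set) vspace"
  where
  "cohomology s Z d n = quotient_space s (cocycles Z d n) (coboundaries Z d n)"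


section \<open>Hochschild cohomology\<close>

text \<open>A \<open>k\<close>-algebra on a subset of an ambient abelian group, whose addition is that of the
  ambient group.\<close>

record ('k, 'a) kalgebra =
  acarrier :: "'a set"
  ascale :: "'k \<Rightarrow> 'a \<Rightarrow> 'a"
  amult :: "'a \<Rightarrow> 'a \<Rightarrow> 'a"

text \<open>\<open>Hom\<^sub>k(A\<^sup>\<otimes>\<^sup>n, A)\<close> as the space of \<open>n\<close>-multilinear maps, given on lists of length \<open>n\<close> over \<open>A\<close>
  and extended by \<open>0\<close> to all other lists.\<close>

definition hochschild_cochains ::
  "('k::field, 'a::ab_group_add) kalgebra \<Rightarrow> nat \<Rightarrow> ('a list \<Rightarrow> 'a) set" where
  "hochschild_cochains A n =
    {f. (\<forall>as. length as = n \<and> set as \<subseteq> acarrier A \<longrightarrow>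
            f as \<in> acarrier A \<and>
            (\<forall>i < n. linear_between (ascale A) (acarrier A) (ascale A) (acarrier A)
                       (\<lambda>x. f (as[i := x])))) \<and>
        (\<forall>as. \<not> (length as = n \<and> set as \<subseteq> acarrier A) \<longrightarrow> f as = 0)}"

text \<open>On \<open>[a\<^sub>0, \<dots>, a\<^sub>n]\<close> this is \<open>a\<^sub>0 f(a\<^sub>1, \<dots>, a\<^sub>n)
  + (\<Sum>i=1..n. (-1)\<^sup>i f(a\<^sub>0, \<dots>, a\<^sub>i\<^sub>-\<^sub>1 a\<^sub>i, \<dots>, a\<^sub>n)) + (-1)\<^sup>n\<^sup>+\<^sup>1 f(a\<^sub>0, \<dots>, a\<^sub>n\<^sub>-\<^sub>1) a\<^sub>n\<close>.\<close>

definition hochschild_differential ::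
  "('k::field, 'a::ab_group_add) kalgebra \<Rightarrow> nat \<Rightarrow> ('a list \<Rightarrow> 'a) \<Rightarrow> ('a list \<Rightarrow> 'a)" where
  "hochschild_differential A n f as =
    (if length as = Suc n \<and> set as \<subseteq> acarrier A then
       amult A (hd as) (f (tl as))
       + (\<Sum>i = 1..n. ascale A ((- 1) ^ i)
            (f (take (i - 1) as @ amult A (as ! (i - 1)) (as ! i) # drop (Suc i) as)))
       + ascale A ((- 1) ^ Suc n) (amult A (f (butlast as)) (last as))
     else 0)"

definition hochschild_cohomology ::
  "('k::field, 'a::ab_group_add) kalgebra \<Rightarrow> nat \<Rightarrow> ('k, ('a list \<Rightarrow> 'a) set) vspace" where
  "hochschild_cohomology A =
    cohomology (\<lambda>c f as. ascale A c (f as)) (hochschild_cochains A) (hochschild_differential A)"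

definition category_algebra :: "('o, 'm) cat \<Rightarrow> ('k::field, 'm \<Rightarrow>\<^sub>0 'k) kalgebra" where
  "category_algebra C =
    \<lparr> acarrier = free_space (Mor C),
      ascale = free_scale,
      amult = (\<lambda>u v. \<Sum>a \<in> Poly_Mapping.keys u. \<Sum>b \<in> Poly_Mapping.keys v.
                 if Src C a = Tgt C b
                 then Poly_Mapping.single (Cmp C a b)
                        (Poly_Mapping.lookup u a * Poly_Mapping.lookup v b)
                 else 0) \<rparr>"


section \<open>Cohomology of the nerve\<close>

text \<open>A chain \<open>a\<^sub>0 \<rightarrow> \<dots> \<rightarrow> a\<^sub>m\<close> is the pair of its list of objects and its list of morphisms.\<close>

definition nerve :: "('o, 'm) cat \<Rightarrow> nat \<Rightarrow> ('o list \<times> 'm list) set" where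
  "nerve D m =
    {(as, gs). length as = Suc m \<and> length gs = m \<and> set as \<subseteq> Obj D \<and>
       (\<forall>i < m. gs ! i \<in> Hom D (as ! i) (as ! Suc i))}"

definition face ::
  "('o, 'm) cat \<Rightarrow> nat \<Rightarrow> nat \<Rightarrow> 'o list \<times> 'm list \<Rightarrow> 'o list \<times> 'm list" where
  "face D m i = (\<lambda>(as, gs).
    if i = 0 then (tl as, tl gs)
    else if i = Suc m then (butlast as, butlast gs)
    else (take i as @ drop (Suc i) as,
          take (i - 1) gs @ Cmp D (gs ! i) (gs ! (i - 1)) # drop (Suc i) gs))"

text \<open>\<open>Hom\<^sub>k(kN\<^sub>m, k)\<close>, with functionals extended by \<open>0\<close> outside \<open>kN\<^sub>m\<close>.\<close>

definition nerve_cochains ::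
  "('o, 'm) cat \<Rightarrow> nat \<Rightarrow> (('o list \<times> 'm list \<Rightarrow>\<^sub>0 'k::field) \<Rightarrow> 'k) set" where
  "nerve_cochains D m =
    {f. linear_between free_scale (free_space (nerve D m)) (*) UNIV f \<and>
        (\<forall>u. u \<notin> free_space (nerve D m) \<longrightarrow> f u = 0)}"

definition nerve_differential ::
  "('o, 'm) cat \<Rightarrow> nat \<Rightarrow> (('o list \<times> 'm list \<Rightarrow>\<^sub>0 'k::field) \<Rightarrow> 'k)
    \<Rightarrow> (('o list \<times> 'm list \<Rightarrow>\<^sub>0 'k) \<Rightarrow> 'k)" where
  "nerve_differential D m f u =
    (if u \<in> free_space (nerve D (Suc m))
     then \<Sum>i \<le> Suc m. (- 1) ^ i * f (free_map (face D m i) u)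
     else 0)"

definition nerve_cohomology ::
  "('o, 'm) cat \<Rightarrow> nat \<Rightarrow> ('k::field, (('o list \<times> 'm list \<Rightarrow>\<^sub>0 'k) \<Rightarrow> 'k) set) vspace" where
  "nerve_cohomology D =
    cohomology (\<lambda>c f u. c * f u) (nerve_cochains D) (nerve_differential D)"

end

(*
  Since endomorphisms can be carried along morphisms in both directions, and uniquely so, a chain
  a_0 -> ... -> a_n of the adjoint category with morphisms g_0, ..., g_(n-1) is the same thing as a
  path in C with an endomorphism of its first object, and it is determined by the path and the
  morphism G a_0 = a_n G parallel to the composite G of the path. The comparison map
  sends a Hochschild cochain f to the coefficient of G a_0 in f(g_(n-1), ..., g_0), up to a sign that
  depends only on n. Extending a cochain of the nerve by zero to all other coefficients is a chain map
  in the other direction and a right inverse, whence surjectivity.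

  If C is rr-transitive, the coefficients of h in f(g_1, ..., g_n) that this forgets are exactly those
  for which (g_1, ..., g_n, h) does not close up to a path parallel to h. On these, inserting an
  identity at the first place where source and target disagree is a contracting homotopy.
*)

theory Submission
  imports Defs HOL.Vector_Spaces
begin

section \<open>Maps induced on cohomology\<close>

text \<open>The outer Hochschild terms sum over all \<open>h'\<close> with
  \<open>g \<circ> h' = h\<close> or \<open>h' \<circ> g = h\<close>, whereas an outer face of a
  chain is a single chain; cancellation leaves at most one \<open>h'\<close>. Extension by zero is a
  chain map only if the differential at an unmatched pair never sees a matched one. The critical
  case is right multiplication: if \<open>h' = G \<circ> a\<close>, left determinism gives
  \<open>h' \<circ> g = G \<circ> g \<circ> a'\<close>, which is again of the required form.
  Finiteness allows every table of coefficients to be summed up to a cochain. Words list the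
  morphisms of a chain backwards, so the face with index \<open>i\<close> meets the Hochschild term
  with index \<open>n + 1 - i\<close>. The two differentials thus differ by
  \<open>(-1)^(n+1)\<close>, and accumulating this over the degrees gives the sign
  \<open>(-1)^(n(n+1)/2)\<close>. The homotopy only reaches coefficients at which the path fails to
  close up. Those of some \<open>h\<close> parallel to \<open>G\<close> but not of the form
  \<open>G \<circ> a\<close> escape it, and rr-transitivity says that there are none. Neither
  complex is normalised, so words with an inserted identity carry values of their own.\<close>

text \<open>The image under \<open>T\<close> of a coset of \<open>B\<close> need not be a full coset
  of \<open>B'\<close>; adding all of \<open>B'\<close> completes it without a choice of
  representatives.\<close>

definition induced_map :: "('v \<Rightarrow> 'w) \<Rightarrow> 'w::ab_group_add set \<Rightarrow> 'v set \<Rightarrow> 'w set" where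
  "induced_map T B' X = {T x + b |x b. x \<in> X \<and> b \<in> B'}"

lemma coset_eq_iff:
  assumes "vector_space s" "module.subspace s B"
  shows "{v + b |b. b \<in> B} = {w + b |b. b \<in> B} \<longleftrightarrow> v - w \<in> (B :: 'v::ab_group_add set)"
proof -
  interpret vector_space s by fact
  note B = subspace_0 [OF assms(2)] subspace_add [OF assms(2)] subspace_diff [OF assms(2)]
  show ?thesis
  proof
    assume "{v + b |b. b \<in> B} = {w + b |b. b \<in> B}"
    moreover have "v + 0 \<in> {v + b |b. b \<in> B}"
      using B(1) by blast
    ultimately obtain b where "v + 0 = w + b" "b \<in> B"
      by blast
    then show "v - w \<in> B"
      by (metis add.right_neutral add_diff_cancel_left')
  next
    assume vw: "v - w \<in> B"
    have "v + b = w + ((v - w) + b)" "w + b = v + (b - (v - w))" for b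
      by simp_all
    then show "{v + b |b. b \<in> B} = {w + b |b. b \<in> B}"
      using B(2,3) vw by blast
  qed
qed

lemma vadd_coset:
  assumes "vector_space s" "module.subspace s B"
  shows "vadd (quotient_space s V B) {v + b |b. b \<in> B} {w + b |b. b \<in> B} = {v + w + b |b. b \<in> B}"
proof -
  interpret vector_space s by fact
  have "\<exists>x y. v + w + b = x + y \<and> (\<exists>b. x = v + b \<and> b \<in> B) \<and> (\<exists>b. y = w + b \<and> b \<in> B)"
    if "b \<in> B" for b
    using that subspace_0 [OF assms(2)]
    by (intro exI [of _ "v + b"] exI [of _ w]) (auto simp: algebra_simps)
  moreover have "\<exists>d. v + b + (w + c) = v + w + d \<and> d \<in> B" if "b \<in> B" "c \<in> B" for b c
    using that subspace_add [OF assms(2)] by (intro exI [of _ "b + c"]) (auto simp: algebra_simps)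
  ultimately show ?thesis
    unfolding quotient_space_def by auto
qed

text \<open>Scaling a coset by 0 leaves only \<open>{0}\<close>. The quotient adds \<open>B\<close>
  once more after scaling, so that the result is a full coset for every scalar.\<close>

lemma vscale_coset:
  assumes "vector_space s" "module.subspace s B"
  shows "vscale (quotient_space s V B) c {v + b |b. b \<in> B} = {s c v + b |b. b \<in> B}"
proof -
  interpret vector_space s by fact
  have "\<exists>x b'. s c v + b = s c x + b' \<and> (\<exists>b. x = v + b \<and> b \<in> B) \<and> b' \<in> B"
    if "b \<in> B" for b
    using that subspace_0 [OF assms(2)] by (intro exI [of _ v] exI [of _ b]) auto
  moreover have "\<exists>d. s c (v + b) + b' = s c v + d \<and> d \<in> B" if "b \<in> B" "b' \<in> B" for b b'
    using that subspace_add [OF assms(2)] subspace_scale [OF assms(2)]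
    by (intro exI [of _ "s c b + b'"]) (auto simp: scale_right_distrib add.assoc)
  ultimately show ?thesis
    unfolding quotient_space_def by auto
qed

text \<open>All three claims come down to one computation: the induced map sends the coset of
  \<open>v\<close> to the coset of \<open>T v\<close>. Injectivity then concerns the difference of
  two representatives.\<close>

lemma
  fixes s :: "'k::field \<Rightarrow> 'v::ab_group_add \<Rightarrow> 'v" and s' :: "'k \<Rightarrow> 'w::ab_group_add \<Rightarrow> 'w" and T :: "'v \<Rightarrow> 'w"
  assumes T: "Vector_Spaces.linear s s' T"
    and B: "module.subspace s B" and B': "module.subspace s' B'"
    and V: "module.subspace s V"
    and TV: "T ` V \<subseteq> V'" and TB: "T ` B \<subseteq> B'"
  shows vlinear_induced_map:
      "vlinear (quotient_space s V B) (quotient_space s' V' B') (induced_map T B')"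
    and induced_map_surj: "V' \<subseteq> T ` V \<Longrightarrow>
      induced_map T B' ` vcarrier (quotient_space s V B) = vcarrier (quotient_space s' V' B')"
    and induced_map_inj: "(\<And>v. v \<in> V \<Longrightarrow> T v \<in> B' \<Longrightarrow> v \<in> B) \<Longrightarrow>
      inj_on (induced_map T B') (vcarrier (quotient_space s V B))"
proof -
  interpret linear s s' T by (rule T)
  note B0 = vs1.subspace_0 [OF B] and B'0 = vs2.subspace_0 [OF B']
  define cos where "cos v = {v + b |b. b \<in> B}" for v
  define cos' where "cos' v = {v + b |b. b \<in> B'}" for v
  have carrier: "vcarrier (quotient_space s V B) = cos ` V"
      "vcarrier (quotient_space s' V' B') = cos' ` V'"
    by (auto simp: quotient_space_def cos_def cos'_def)
  have ind: "induced_map T B' (cos v) = cos' (T v)" for v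
  proof -
    have "T (v + b) + b' = T v + (T b + b')" for b b'
      by (simp add: add add.assoc)
    moreover have "T b + b' \<in> B'" if "b \<in> B" "b' \<in> B'" for b b'
      using that TB vs2.subspace_add [OF B'] by blast
    ultimately have "induced_map T B' (cos v) \<subseteq> cos' (T v)"
      unfolding induced_map_def cos_def cos'_def by blast
    moreover have "T v + b' = T (v + 0) + b'" for b'
      by simp
    then have "cos' (T v) \<subseteq> induced_map T B' (cos v)"
      unfolding induced_map_def cos_def cos'_def using B0 by blast
    ultimately show ?thesis ..
  qed
  note vadd_cos = vadd_coset [OF vs1.vector_space_axioms B, of V, folded cos_def]
    and vadd_cos' = vadd_coset [OF vs2.vector_space_axioms B', of V', folded cos'_def]
    and vscale_cos = vscale_coset [OF vs1.vector_space_axioms B, of V, folded cos_def]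
    and vscale_cos' = vscale_coset [OF vs2.vector_space_axioms B', of V', folded cos'_def]
  show "vlinear (quotient_space s V B) (quotient_space s' V' B') (induced_map T B')"
    unfolding vlinear_def carrier using TV
    by (auto simp: ind vadd_cos vadd_cos' vscale_cos vscale_cos' add scale)
  show "induced_map T B' ` vcarrier (quotient_space s V B) = vcarrier (quotient_space s' V' B')"
    if "V' \<subseteq> T ` V"
    using that TV unfolding carrier image_image ind by blast
  show "inj_on (induced_map T B') (vcarrier (quotient_space s V B))"
    if ker: "\<And>v. v \<in> V \<Longrightarrow> T v \<in> B' \<Longrightarrow> v \<in> B"
  proof (rule inj_onI)
    fix X Y assume "X \<in> vcarrier (quotient_space s V B)" "Y \<in> vcarrier (quotient_space s V B)"
      and eq: "induced_map T B' X = induced_map T B' Y"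
    then obtain v w where vw: "v \<in> V" "w \<in> V" "X = cos v" "Y = cos w"
      unfolding carrier by blast
    with eq have "cos' (T v) = cos' (T w)"
      by (simp add: ind)
    then have "T (v - w) \<in> B'"
      using coset_eq_iff [OF vs2.vector_space_axioms B'] by (simp add: cos'_def diff)
    then have "v - w \<in> B"
      using ker vs1.subspace_diff [OF V] vw by blast
    then show "X = Y"
      using coset_eq_iff [OF vs1.vector_space_axioms B] vw by (simp add: cos_def)
  qed
qed

lemma subspace_cocycles:
  fixes s :: "'k::field \<Rightarrow> 'v::ab_group_add \<Rightarrow> 'v"
  assumes "Vector_Spaces.linear s s (d n)" "module.subspace s (Z n)"
  shows "module.subspace s (cocycles Z d n)"
proof -
  interpret linear s s "d n" by fact
  show ?thesis
    using assms(2) unfolding cocycles_def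
    by (intro vs1.subspaceI)
       (auto simp: add scale zero vs1.subspace_0 vs1.subspace_add vs1.subspace_scale)
qed

lemma subspace_coboundaries:
  fixes s :: "'k::field \<Rightarrow> 'v::ab_group_add \<Rightarrow> 'v"
  assumes "\<And>n. Vector_Spaces.linear s s (d n)" "\<And>n. module.subspace s (Z n)"
  shows "module.subspace s (coboundaries Z d n)"
proof (cases n)
  case 0
  interpret linear s s "d n" by (rule assms)
  show ?thesis
    using 0 by simp
next
  case (Suc m)
  interpret linear s s "d m" by (rule assms)
  show ?thesis
    using Suc subspace_image [OF assms(2)] by simp
qed

text \<open>A chain map respects cocycles and coboundaries, which is what the quotient construction
  asks for. Surjectivity is stated for cocycles and not just for classes, since the comparison map
  has a right inverse on cochains.\<close>

lemma
  fixes s :: "'k::field \<Rightarrow> 'v::ab_group_add \<Rightarrow> 'v" and s' :: "'k \<Rightarrow> 'w::ab_group_add \<Rightarrow> 'w" and T :: "nat \<Rightarrow> 'v \<Rightarrow> 'w"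
  assumes d: "\<And>n. Vector_Spaces.linear s s (d n)" and d': "\<And>n. Vector_Spaces.linear s' s' (d' n)"
    and Z: "\<And>n. module.subspace s (Z n)" and Z': "\<And>n. module.subspace s' (Z' n)"
    and T: "\<And>n. Vector_Spaces.linear s s' (T n)"
    and TZ: "\<And>n f. f \<in> Z n \<Longrightarrow> T n f \<in> Z' n"
    and comm: "\<And>n f. f \<in> Z n \<Longrightarrow> T (Suc n) (d n f) = d' n (T n f)"
  shows vlinear_cohomology_map:
      "vlinear (cohomology s Z d n) (cohomology s' Z' d' n)
        (induced_map (T n) (coboundaries Z' d' n))"
    and cohomology_map_surj: "cocycles Z' d' n \<subseteq> T n ` cocycles Z d n \<Longrightarrow>
      induced_map (T n) (coboundaries Z' d' n) ` vcarrier (cohomology s Z d n)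
        = vcarrier (cohomology s' Z' d' n)"
    and cohomology_map_inj: "(\<And>v. v \<in> cocycles Z d n \<Longrightarrow> T n v \<in> coboundaries Z' d' n \<Longrightarrow>
        v \<in> coboundaries Z d n) \<Longrightarrow>
      inj_on (induced_map (T n) (coboundaries Z' d' n)) (vcarrier (cohomology s Z d n))"
proof -
  have zero: "T n 0 = 0" for n
    using T module_hom.zero Vector_Spaces.linear.axioms(3) by blast
  have TV: "T n ` cocycles Z d n \<subseteq> cocycles Z' d' n"
    using TZ comm zero by (force simp: cocycles_def)
  have TB: "T n ` coboundaries Z d n \<subseteq> coboundaries Z' d' n"
    using TZ comm zero by (cases n) auto
  note * = T subspace_coboundaries [of s d, OF d Z] subspace_coboundaries [of s' d', OF d' Z']
    subspace_cocycles [of s d, OF d Z] TV TB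
  show "vlinear (cohomology s Z d n) (cohomology s' Z' d' n)
        (induced_map (T n) (coboundaries Z' d' n))"
    unfolding cohomology_def by (rule vlinear_induced_map [OF *])
  show "induced_map (T n) (coboundaries Z' d' n) ` vcarrier (cohomology s Z d n)
        = vcarrier (cohomology s' Z' d' n)" if "cocycles Z' d' n \<subseteq> T n ` cocycles Z d n"
    unfolding cohomology_def by (rule induced_map_surj [OF * that])
  show "inj_on (induced_map (T n) (coboundaries Z' d' n)) (vcarrier (cohomology s Z d n))"
    if "\<And>v. v \<in> cocycles Z d n \<Longrightarrow> T n v \<in> coboundaries Z' d' n \<Longrightarrow> v \<in> coboundaries Z d n"
    unfolding cohomology_def by (rule induced_map_inj [OF * that])
qed

section \<open>Free vector spaces\<close>

abbreviation basis :: "'x \<Rightarrow> 'x \<Rightarrow>\<^sub>0 'k::field" where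
  "basis x \<equiv> Poly_Mapping.single x 1"

lemma lookup_free_scale [simp]:
  "Poly_Mapping.lookup (free_scale c u) x = c * Poly_Mapping.lookup u x"
  unfolding free_scale_def by (simp add: Poly_Mapping.map.rep_eq when_def)

lemma free_scale_zero_right [simp]: "free_scale c 0 = 0"
  by (rule poly_mapping_eqI) simp

lemma free_scale_add_right: "free_scale c (u + v) = free_scale c u + free_scale c v"
  by (rule poly_mapping_eqI) (simp add: lookup_add algebra_simps)

lemma free_scale_left_commute: "free_scale c (free_scale d u) = free_scale d (free_scale c u)"
  by (rule poly_mapping_eqI) simp

lemma free_scale_sum_right: "free_scale c (sum g I) = (\<Sum>i \<in> I. free_scale c (g i))"
  by (rule poly_mapping_eqI) (simp add: lookup_sum sum_distrib_left)

lemma mem_free_space_iff: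
  "u \<in> free_space X \<longleftrightarrow> (\<forall>x. x \<notin> X \<longrightarrow> Poly_Mapping.lookup u x = 0)"
  by (auto simp: free_space_def in_keys_iff)

lemma basis_mem_free_space [simp]: "basis x \<in> free_space X \<longleftrightarrow> x \<in> X"
  by (simp add: free_space_def)

lemma zero_mem_free_space [simp]: "0 \<in> free_space X"
  by (simp add: free_space_def)

lemma add_mem_free_space:
  "u \<in> free_space X \<Longrightarrow> v \<in> free_space X \<Longrightarrow> u + v \<in> free_space X"
  by (simp add: mem_free_space_iff lookup_add)

lemma free_scale_mem_free_space: "u \<in> free_space X \<Longrightarrow> free_scale c u \<in> free_space X"
  by (simp add: mem_free_space_iff)

lemma sum_mem_free_space:
  "(\<And>i. i \<in> I \<Longrightarrow> f i \<in> free_space X) \<Longrightarrow> sum f I \<in> free_space X"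
  by (simp add: mem_free_space_iff lookup_sum)

lemma vector_space_free_scale_pointwise:
  "vector_space (\<lambda>c (f :: 'y \<Rightarrow> 'x \<Rightarrow>\<^sub>0 'k::field) y. free_scale c (f y))"
  by unfold_locales
    (auto simp: fun_eq_iff algebra_simps lookup_add intro!: poly_mapping_eqI)

lemma vector_space_times_pointwise: "vector_space (\<lambda>c (f :: 'y \<Rightarrow> 'k::field) y. c * f y)"
  by unfold_locales (auto simp: fun_eq_iff algebra_simps)

text \<open>Supports can shrink under addition and scaling, so sums over \<open>keys\<close> of
  different elements are compared over a common finite superset.\<close>

lemma sum_keys_superset:
  assumes "finite X" "Poly_Mapping.keys u \<subseteq> X" "\<And>x. F x 0 = 0"
  shows "(\<Sum>x \<in> Poly_Mapping.keys u. F x (Poly_Mapping.lookup u x))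
    = (\<Sum>x \<in> X. F x (Poly_Mapping.lookup u x))"
  using assms by (intro sum.mono_neutral_left) (auto simp: in_keys_iff)

lemma free_space_sum_basis:
  "u = (\<Sum>x \<in> Poly_Mapping.keys u. free_scale (Poly_Mapping.lookup u x) (basis x))"
proof (rule poly_mapping_eqI)
  fix y
  have "(\<Sum>x \<in> Poly_Mapping.keys u.
      Poly_Mapping.lookup (free_scale (Poly_Mapping.lookup u x) (basis x)) y)
    = (\<Sum>x \<in> Poly_Mapping.keys u. if x = y then Poly_Mapping.lookup u x else 0)"
    by (intro sum.cong) (auto simp: lookup_single when_def)
  then show "Poly_Mapping.lookup u y = Poly_Mapping.lookup
      (\<Sum>x \<in> Poly_Mapping.keys u. free_scale (Poly_Mapping.lookup u x) (basis x)) y"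
    by (simp add: lookup_sum in_keys_iff)
qed

lemma linear_between_free_expand:
  fixes f :: "('x \<Rightarrow>\<^sub>0 'k::field) \<Rightarrow> 'w::ab_group_add"
  assumes f: "linear_between free_scale (free_space X) t W f" and u: "u \<in> free_space X"
  shows "f u = (\<Sum>x \<in> Poly_Mapping.keys u. t (Poly_Mapping.lookup u x) (f (basis x)))"
proof -
  have add: "f (v + w) = f v + f w" if "v \<in> free_space X" "w \<in> free_space X" for v w
    using f that by (simp add: linear_between_def)
  have scale: "f (free_scale c v) = t c (f v)" if "v \<in> free_space X" for c v
    using f that by (simp add: linear_between_def)
  \<comment> \<open>\<open>linear_between\<close> does not list preservation of 0; additivity forces
    it.\<close>
  have "f 0 + f 0 = f 0"
    using add [of 0 0] by simp
  then have zero: "f 0 = 0"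
    by simp
  have "f (\<Sum>x \<in> I. free_scale (c x) (basis x)) = (\<Sum>x \<in> I. t (c x) (f (basis x)))"
    if "finite I" "I \<subseteq> X" for I and c :: "'x \<Rightarrow> 'k"
    using that
  proof (induction I)
    case (insert x I)
    then have "(\<Sum>x \<in> I. free_scale (c x) (basis x)) \<in> free_space X"
      by (intro sum_mem_free_space free_scale_mem_free_space) auto
    with insert show ?case
      by (simp add: add scale free_scale_mem_free_space)
  qed (simp add: zero)
  from this [of "Poly_Mapping.keys u" "Poly_Mapping.lookup u"] show ?thesis
    using u free_space_sum_basis [of u] by (simp add: free_space_def)
qed

section \<open>Hochschild cochains of a category algebra\<close>

lemma category_algebra_simps [simp]:
  "acarrier (category_algebra C) = free_space (Mor C)"
  "ascale (category_algebra C) = free_scale"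
  by (simp_all add: category_algebra_def)

text \<open>With both supports enlarged to fixed finite sets, different products become sums over
  the same indices, and bilinearity can be read off coefficientwise.\<close>

lemma amult_category_algebra:
  assumes "finite X" "finite Y" "Poly_Mapping.keys u \<subseteq> X" "Poly_Mapping.keys v \<subseteq> Y"
  shows "amult (category_algebra C) u v = (\<Sum>a \<in> X. \<Sum>b \<in> Y.
    if Src C a = Tgt C b
    then Poly_Mapping.single (Cmp C a b) (Poly_Mapping.lookup u a * Poly_Mapping.lookup v b)
    else 0)"
proof -
  let ?F = "\<lambda>a b. if Src C a = Tgt C b
    then Poly_Mapping.single (Cmp C a b) (Poly_Mapping.lookup u a * Poly_Mapping.lookup v b)
    else 0"
  have "amult (category_algebra C) u v
      = (\<Sum>a \<in> Poly_Mapping.keys u. \<Sum>b \<in> Poly_Mapping.keys v. ?F a b)"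
    by (simp add: category_algebra_def)
  also have "\<dots> = (\<Sum>a \<in> Poly_Mapping.keys u. \<Sum>b \<in> Y. ?F a b)"
    by (intro sum.cong refl sum.mono_neutral_left assms) (simp add: in_keys_iff)
  also have "\<dots> = (\<Sum>a \<in> X. \<Sum>b \<in> Y. ?F a b)"
    by (intro sum.mono_neutral_left assms) (auto simp: in_keys_iff intro!: sum.neutral)
  finally show ?thesis .
qed

lemma lookup_amult_category_algebra:
  assumes "finite X" "finite Y" "Poly_Mapping.keys u \<subseteq> X" "Poly_Mapping.keys v \<subseteq> Y"
  shows "Poly_Mapping.lookup (amult (category_algebra C) u v) h = (\<Sum>a \<in> X. \<Sum>b \<in> Y.
    if Src C a = Tgt C b \<and> Cmp C a b = h
    then Poly_Mapping.lookup u a * Poly_Mapping.lookup v b else 0)"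
  unfolding amult_category_algebra [OF assms] lookup_sum
  by (intro sum.cong) (auto simp: lookup_single when_def)

lemma amult_category_algebra_add_left:
  "amult (category_algebra C) (u + v) w
    = amult (category_algebra C) u w + amult (category_algebra C) v w"
proof -
  let ?X = "Poly_Mapping.keys u \<union> Poly_Mapping.keys v" and ?Y = "Poly_Mapping.keys w"
  have "finite ?X" "finite ?Y" "Poly_Mapping.keys (u + v) \<subseteq> ?X" "Poly_Mapping.keys u \<subseteq> ?X"
    "Poly_Mapping.keys v \<subseteq> ?X" "Poly_Mapping.keys w \<subseteq> ?Y"
    by (auto dest: subsetD [OF keys_add])
  then show ?thesis
    by (intro poly_mapping_eqI)
       (auto simp: lookup_add lookup_amult_category_algebra [of ?X ?Y] sum.distrib [symmetric]
         algebra_simps intro!: sum.cong)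
qed

lemma amult_category_algebra_add_right:
  "amult (category_algebra C) w (u + v)
    = amult (category_algebra C) w u + amult (category_algebra C) w v"
proof -
  let ?X = "Poly_Mapping.keys u \<union> Poly_Mapping.keys v" and ?Y = "Poly_Mapping.keys w"
  have "finite ?X" "finite ?Y" "Poly_Mapping.keys (u + v) \<subseteq> ?X" "Poly_Mapping.keys u \<subseteq> ?X"
    "Poly_Mapping.keys v \<subseteq> ?X" "Poly_Mapping.keys w \<subseteq> ?Y"
    by (auto dest: subsetD [OF keys_add])
  then show ?thesis
    by (intro poly_mapping_eqI)
       (auto simp: lookup_add lookup_amult_category_algebra [of ?Y ?X] sum.distrib [symmetric]
         algebra_simps intro!: sum.cong)
qed

lemma keys_free_scale_subset: "Poly_Mapping.keys (free_scale c u) \<subseteq> Poly_Mapping.keys u"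
  by (auto simp: in_keys_iff)

lemma amult_category_algebra_scale_left:
  "amult (category_algebra C) (free_scale c u) v = free_scale c (amult (category_algebra C) u v)"
  using keys_free_scale_subset [of c u]
  by (intro poly_mapping_eqI)
     (auto simp: lookup_amult_category_algebra [of "Poly_Mapping.keys u" "Poly_Mapping.keys v"]
       sum_distrib_left mult.assoc intro!: sum.cong)

lemma amult_category_algebra_scale_right:
  "amult (category_algebra C) u (free_scale c v) = free_scale c (amult (category_algebra C) u v)"
  using keys_free_scale_subset [of c v]
  by (intro poly_mapping_eqI)
     (auto simp: lookup_amult_category_algebra [of "Poly_Mapping.keys u" "Poly_Mapping.keys v"]
       sum_distrib_left algebra_simps intro!: sum.cong)

lemma amult_basis_basis:
  "amult (category_algebra C) (basis g) (basis h :: 'm \<Rightarrow>\<^sub>0 'k::field)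
    = (if Src C g = Tgt C h then basis (Cmp C g h) else 0)"
  by (subst amult_category_algebra [of "{g}" "{h}"]) auto

context category
begin

lemma Hom_iff: "f \<in> Hom C x y \<longleftrightarrow> f \<in> Mor C \<and> Src C f = x \<and> Tgt C f = y"
  by (simp add: Hom_def)

lemma
  assumes "f \<in> Mor C" "g \<in> Mor C" "Src C g = Tgt C f"
  shows Cmp_in_Mor: "Cmp C g f \<in> Mor C"
    and Src_Cmp: "Src C (Cmp C g f) = Src C f"
    and Tgt_Cmp: "Tgt C (Cmp C g f) = Tgt C g"
  using Cmp_in_Hom [of f "Src C f" "Tgt C f" g "Tgt C g"] assms by (auto simp: Hom_iff)

lemma
  assumes "x \<in> Obj C"
  shows Idm_in_Mor: "Idm C x \<in> Mor C"
    and Src_Idm: "Src C (Idm C x) = x"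
    and Tgt_Idm: "Tgt C (Idm C x) = x"
  using Idm_in_End [OF assms] by (auto simp: Hom_iff)

lemma Cmp_Idm_Tgt: "f \<in> Mor C \<Longrightarrow> Cmp C (Idm C (Tgt C f)) f = f"
  and Cmp_Idm_Src: "f \<in> Mor C \<Longrightarrow> Cmp C f (Idm C (Src C f)) = f"
  using Cmp_Idm_left [of f "Src C f"] Cmp_Idm_right [of f "Src C f"] by (auto simp: Hom_iff)

lemma Cmp_assoc_Mor:
  assumes "f \<in> Mor C" "g \<in> Mor C" "h \<in> Mor C" "Src C g = Tgt C f" "Src C h = Tgt C g"
  shows "Cmp C (Cmp C h g) f = Cmp C h (Cmp C g f)"
  using Cmp_assoc [of f "Src C f" "Tgt C f" g "Tgt C g" h "Tgt C h"] assms by (auto simp: Hom_iff)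

lemma amult_mem_free_space_Mor:
  assumes "u \<in> free_space (Mor C)" "v \<in> free_space (Mor C)"
  shows "amult (category_algebra C) u v \<in> free_space (Mor C)"
proof -
  have "Poly_Mapping.single (Cmp C a b) c \<in> free_space (Mor C)"
    if "a \<in> Poly_Mapping.keys u" "b \<in> Poly_Mapping.keys v" "Src C a = Tgt C b" for a b and c :: 'a
    using that assms Cmp_in_Mor [of b a] by (auto simp: free_space_def)
  then show ?thesis
    unfolding amult_category_algebra [OF finite_keys finite_keys subset_refl subset_refl]
    by (auto intro!: sum_mem_free_space)
qed

end

context finite_category
begin

lemma finite_Mor: "finite (Mor C)"
proof -
  have "Mor C \<subseteq> (\<Union>x \<in> Obj C. \<Union>y \<in> Obj C. Hom C x y)"
    using Src_in_Obj Tgt_in_Obj by (auto simp: Hom_iff)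
  then show ?thesis
    using finite_Obj finite_Hom by (auto intro: finite_subset)
qed

text \<open>Multiplying by \<open>g\<close> may send several basis elements to \<open>h\<close>, so
  a coefficient of the product collects all factorisations of \<open>h\<close> through
  \<open>g\<close>.\<close>

lemma lookup_amult_basis_left:
  assumes "u \<in> free_space (Mor C)"
  shows "Poly_Mapping.lookup (amult (category_algebra C) (basis g) u) h
    = (\<Sum>h' | h' \<in> Mor C \<and> Src C g = Tgt C h' \<and> Cmp C g h' = h. Poly_Mapping.lookup u h')"
proof -
  have "Poly_Mapping.lookup (amult (category_algebra C) (basis g) u) h
    = (\<Sum>h' \<in> Mor C. if Src C g = Tgt C h' \<and> Cmp C g h' = h then Poly_Mapping.lookup u h' else 0)"
    using assms finite_Mor
    by (subst lookup_amult_category_algebra [of "{g}" "Mor C"])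
       (auto simp: free_space_def intro!: sum.cong)
  then show ?thesis
    using finite_Mor by (simp add: sum.inter_filter [symmetric])
qed

lemma lookup_amult_basis_right:
  assumes "u \<in> free_space (Mor C)"
  shows "Poly_Mapping.lookup (amult (category_algebra C) u (basis g)) h
    = (\<Sum>h' | h' \<in> Mor C \<and> Src C h' = Tgt C g \<and> Cmp C h' g = h. Poly_Mapping.lookup u h')"
proof -
  have "Poly_Mapping.lookup (amult (category_algebra C) u (basis g)) h
    = (\<Sum>h' \<in> Mor C. if Src C h' = Tgt C g \<and> Cmp C h' g = h then Poly_Mapping.lookup u h' else 0)"
    using assms finite_Mor
    by (subst lookup_amult_category_algebra [of "Mor C" "{g}"])
       (auto simp: free_space_def intro!: sum.cong)
  then show ?thesis
    using finite_Mor by (simp add: sum.inter_filter [symmetric])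
qed

end

section \<open>Multilinearity of Hochschild cochains and of their differential\<close>

abbreviation hh_cochains :: "('o, 'm) cat \<Rightarrow> nat \<Rightarrow> (('m \<Rightarrow>\<^sub>0 'k::field) list \<Rightarrow> ('m \<Rightarrow>\<^sub>0 'k)) set"
  where "hh_cochains C \<equiv> hochschild_cochains (category_algebra C)"

abbreviation hh_differential :: "('o, 'm) cat \<Rightarrow> nat \<Rightarrow> (('m \<Rightarrow>\<^sub>0 'k::field) list \<Rightarrow> ('m \<Rightarrow>\<^sub>0 'k))
    \<Rightarrow> (('m \<Rightarrow>\<^sub>0 'k) list \<Rightarrow> ('m \<Rightarrow>\<^sub>0 'k))"
  where "hh_differential C \<equiv> hochschild_differential (category_algebra C)"

abbreviation free_linear :: "'x set \<Rightarrow> (('x \<Rightarrow>\<^sub>0 'k::field) \<Rightarrow> ('x \<Rightarrow>\<^sub>0 'k)) \<Rightarrow> bool" where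
  "free_linear X \<equiv> linear_between free_scale (free_space X) free_scale (free_space X)"

lemma hh_cochainsI:
  assumes "\<And>as. length as = n \<Longrightarrow> set as \<subseteq> free_space (Mor C) \<Longrightarrow> f as \<in> free_space (Mor C)"
    and "\<And>as i. length as = n \<Longrightarrow> set as \<subseteq> free_space (Mor C) \<Longrightarrow> i < n \<Longrightarrow>
      free_linear (Mor C) (\<lambda>x. f (as[i := x]))"
    and "\<And>as. \<not> (length as = n \<and> set as \<subseteq> free_space (Mor C)) \<Longrightarrow> f as = 0"
  shows "f \<in> hh_cochains C n"
  using assms by (simp add: hochschild_cochains_def)

lemma
  assumes "f \<in> hh_cochains C n"
  shows hh_cochains_mem: "length as = n \<Longrightarrow> set as \<subseteq> free_space (Mor C) \<Longrightarrow>
      f as \<in> free_space (Mor C)"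
    and hh_cochains_linear: "length as = n \<Longrightarrow> set as \<subseteq> free_space (Mor C) \<Longrightarrow> i < n \<Longrightarrow>
      free_linear (Mor C) (\<lambda>x. f (as[i := x]))"
    and hh_cochains_outside: "\<not> (length as = n \<and> set as \<subseteq> free_space (Mor C)) \<Longrightarrow> f as = 0"
  using assms by (simp_all add: hochschild_cochains_def)

lemma free_linear_add: "free_linear X f \<Longrightarrow> free_linear X g \<Longrightarrow> free_linear X (\<lambda>x. f x + g x)"
  by (simp add: linear_between_def add_mem_free_space free_scale_add_right algebra_simps)

lemma free_linear_scale: "free_linear X f \<Longrightarrow> free_linear X (\<lambda>x. free_scale c (f x))"
  by (simp add: linear_between_def free_scale_mem_free_space free_scale_add_right
      free_scale_left_commute)

lemma free_linear_zero: "free_linear X (\<lambda>x. 0)"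
  by (simp add: linear_between_def)

lemma free_linear_sum: "(\<And>i. i \<in> I \<Longrightarrow> free_linear X (f i)) \<Longrightarrow> free_linear X (\<lambda>x. \<Sum>i \<in> I. f i x)"
  by (induction I rule: infinite_finite_induct) (simp_all add: free_linear_zero free_linear_add)

lemma free_linear_compose:
  "free_linear X f \<Longrightarrow> free_linear X g \<Longrightarrow> free_linear X (\<lambda>x. f (g x))"
  by (simp add: linear_between_def)

lemma free_linear_eq_on:
  "free_linear X f \<Longrightarrow> (\<And>x. x \<in> free_space X \<Longrightarrow> g x = f x) \<Longrightarrow> free_linear X g"
  by (simp add: linear_between_def add_mem_free_space free_scale_mem_free_space)

lemma (in category) free_linear_amult_left:
  "u \<in> free_space (Mor C) \<Longrightarrow> free_linear (Mor C) (\<lambda>x. amult (category_algebra C) x u)"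
  by (simp add: linear_between_def amult_mem_free_space_Mor amult_category_algebra_add_left
      amult_category_algebra_scale_left)

lemma (in category) free_linear_amult_right:
  "u \<in> free_space (Mor C) \<Longrightarrow> free_linear (Mor C) (\<lambda>x. amult (category_algebra C) u x)"
  by (simp add: linear_between_def amult_mem_free_space_Mor amult_category_algebra_add_right
      amult_category_algebra_scale_right)

lemma hh_cochains_zero: "0 \<in> hh_cochains C n"
  by (rule hh_cochainsI) (auto simp: free_linear_zero)

lemma hh_cochains_add: "f \<in> hh_cochains C n \<Longrightarrow> g \<in> hh_cochains C n \<Longrightarrow> f + g \<in> hh_cochains C n"
  by (rule hh_cochainsI)
    (auto simp: hh_cochains_mem hh_cochains_outside hh_cochains_linear add_mem_free_space
      free_linear_add)

lemma subspace_hh_cochains: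
  "module.subspace (\<lambda>c f as. ascale (category_algebra C) c (f as))
    (hh_cochains C n :: (('m \<Rightarrow>\<^sub>0 'k::field) list \<Rightarrow> _) set)"
proof -
  interpret vector_space "\<lambda>c (f :: ('m \<Rightarrow>\<^sub>0 'k) list \<Rightarrow> 'm \<Rightarrow>\<^sub>0 'k) as. free_scale c (f as)"
    by (rule vector_space_free_scale_pointwise)
  show ?thesis
    unfolding category_algebra_simps
    by (intro subspaceI hh_cochains_zero hh_cochains_add hh_cochainsI)
       (auto simp: hh_cochains_mem hh_cochains_outside hh_cochains_linear
         free_scale_mem_free_space free_linear_scale)
qed

text \<open>Linearity holds on all functions and not only on cochains, because the product is
  bilinear on the whole ambient space. The lemmas on induced maps ask for it in this form.\<close>

lemma linear_hh_differential:
  "Vector_Spaces.linear (\<lambda>c f as. ascale (category_algebra C) c (f as))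
     (\<lambda>c f as. ascale (category_algebra C) c (f as))
     (hh_differential C n :: (('m \<Rightarrow>\<^sub>0 'k::field) list \<Rightarrow> _) \<Rightarrow> _)"
proof -
  interpret vector_space "\<lambda>c (f :: ('m \<Rightarrow>\<^sub>0 'k) list \<Rightarrow> 'm \<Rightarrow>\<^sub>0 'k) as. free_scale c (f as)"
    by (rule vector_space_free_scale_pointwise)
  show ?thesis
    unfolding category_algebra_simps
  proof (unfold_locales, goal_cases)
    case (1 f g)
    show ?case
      by (rule ext) (simp add: hochschild_differential_def amult_category_algebra_add_left
          amult_category_algebra_add_right free_scale_add_right sum.distrib)
  next
    case (2 c f)
    show ?case
      by (rule ext) (simp add: hochschild_differential_def amult_category_algebra_scale_left
          amult_category_algebra_scale_right free_scale_add_right free_scale_sum_right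
          free_scale_left_commute [of _ c])
  qed
qed

text \<open>Linearity in a slot is checked term by term. An outer term uses the slot as an algebra
  factor or hands it on to \<open>f\<close>; an inner term multiplies it with a neighbour or moves
  it to another slot of \<open>f\<close>.\<close>

lemma (in category) hh_differential_mem:
  fixes f :: "('m \<Rightarrow>\<^sub>0 'k::field) list \<Rightarrow> ('m \<Rightarrow>\<^sub>0 'k)"
  assumes f: "f \<in> hh_cochains C n"
  shows "hh_differential C n f \<in> hh_cochains C (Suc n)"
proof (rule hh_cochainsI)
  let ?A = "free_space (Mor C) :: ('m \<Rightarrow>\<^sub>0 'k) set"
  let ?m = "amult (category_algebra C) :: ('m \<Rightarrow>\<^sub>0 'k) \<Rightarrow> _"
  define con where "con i as = take (i - 1) as @ ?m (as ! (i - 1)) (as ! i) # drop (Suc i) as" for i as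
  have con_set: "length (con i as) = n \<and> set (con i as) \<subseteq> ?A"
    if "length as = Suc n" "set as \<subseteq> ?A" "i \<in> {1..n}" for i as
    using that set_take_subset [of "i - 1" as] set_drop_subset [of "Suc i" as]
    by (auto simp: con_def subset_iff intro!: amult_mem_free_space_Mor)
  have unfold: "hh_differential C n f as = ?m (hd as) (f (tl as))
      + (\<Sum>i = 1..n. free_scale ((- 1) ^ i) (f (con i as)))
      + free_scale ((- 1) ^ Suc n) (?m (f (butlast as)) (last as))"
    if "length as = Suc n" "set as \<subseteq> ?A" for as
    unfolding hochschild_differential_def con_def using that by simp
  have tl: "length (tl as) = n \<and> set (tl as) \<subseteq> ?A \<and> hd as \<in> ?A"
    and bl: "length (butlast as) = n \<and> set (butlast as) \<subseteq> ?A \<and> last as \<in> ?A"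
    if "length as = Suc n" "set as \<subseteq> ?A" for as
    using that by (cases as; auto dest: in_set_butlastD)+
  {
    fix as assume as: "length as = Suc n" "set as \<subseteq> ?A"
    show "hh_differential C n f as \<in> ?A"
      unfolding unfold [OF as] using con_set [OF as] tl [OF as] bl [OF as]
      by (intro add_mem_free_space sum_mem_free_space free_scale_mem_free_space
          amult_mem_free_space_Mor hh_cochains_mem [OF f]) auto
    fix j assume j: "j < Suc n"
    have upd: "length (as[j := x]) = Suc n \<and> set (as[j := x]) \<subseteq> ?A" if "x \<in> ?A" for x
      using as that set_update_subset_insert [of as j x] by auto
    have first: "free_linear (Mor C) (\<lambda>x. ?m (hd (as[j := x])) (f (tl (as[j := x]))))"
    proof (cases j)
      case 0
      have "?m (hd (as[j := x])) (f (tl (as[j := x]))) = ?m x (f (tl as))" for x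
        using as 0 by (cases as) auto
      then show ?thesis
        using tl [OF as] hh_cochains_mem [OF f] by (simp add: free_linear_amult_left)
    next
      case (Suc i)
      have "?m (hd (as[j := x])) (f (tl (as[j := x]))) = ?m (hd as) (f ((tl as)[i := x]))" for x
        using as Suc by (cases as) auto
      moreover have "i < n"
        using Suc j by simp
      ultimately show ?thesis
        using tl [OF as] hh_cochains_linear [OF f]
          free_linear_compose [OF free_linear_amult_right, of "hd as" "\<lambda>x. f ((tl as)[i := x])"]
        by simp
    qed
    have last: "free_linear (Mor C) (\<lambda>x. ?m (f (butlast (as[j := x]))) (last (as[j := x])))"
    proof (cases "j = n")
      case True
      have "?m (f (butlast (as[j := x]))) (last (as[j := x])) = ?m (f (butlast as)) x" for x
        using as True by (cases "as = []") (simp_all add: butlast_list_update last_list_update)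
      then show ?thesis
        using bl [OF as] hh_cochains_mem [OF f] by (simp add: free_linear_amult_right)
    next
      case False
      have "?m (f (butlast (as[j := x]))) (last (as[j := x])) = ?m (f ((butlast as)[j := x])) (last as)"
        for x
        using as False by (cases "as = []") (simp_all add: butlast_list_update last_list_update)
      moreover have "j < n"
        using False j by simp
      ultimately show ?thesis
        using bl [OF as] hh_cochains_linear [OF f]
          free_linear_compose [OF free_linear_amult_left, of "last as" "\<lambda>x. f ((butlast as)[j := x])"]
        by simp
    qed
    have middle: "free_linear (Mor C) (\<lambda>x. f (con i (as[j := x])))" if i: "i \<in> {1..n}" for i
    proof -
      have nth: "as ! p \<in> ?A" if "p < Suc n" for p
        using as that nth_mem [of p as] by auto
      \<comment> \<open>Contracting slots \<open>i - 1\<close> and \<open>i\<close> moves everything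
        from slot \<open>i\<close> on down by one place, so \<open>p\<close> is where slot
        \<open>j\<close> ends up. For \<open>j = i - 1\<close> and for \<open>j = i\<close> this is
        the contracted slot.\<close>
      define p where "p = (if j < i then j else j - 1)"
      have "p < n"
        using i j by (auto simp: p_def)
      note lin = hh_cochains_linear [OF f, of "con i as" p] con_set [OF as i] \<open>p < n\<close>
      consider "j < i - 1" | "j = i - 1" | "j = i" | "j > i"
        by linarith
      then show ?thesis
      proof cases
        case 1
        have "con i (as[j := x]) = (con i as)[p := x]" for x
          using 1 i as by (intro nth_equalityI)
            (auto simp: con_def p_def nth_append nth_list_update nth_Cons split: nat.splits)
        then show ?thesis
          using lin by simp
      next
        case 2
        have "con i (as[j := x]) = (con i as)[p := ?m x (as ! i)]" for x
          using 2 i as by (intro nth_equalityI)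
            (auto simp: con_def p_def nth_append nth_list_update nth_Cons split: nat.splits)
        then show ?thesis
          using lin free_linear_compose [OF _ free_linear_amult_left [of "as ! i"],
            of "\<lambda>x. f ((con i as)[p := x])"] nth i by simp
      next
        case 3
        have "con i (as[j := x]) = (con i as)[p := ?m (as ! (i - 1)) x]" if "p = i - 1" for x
          using 3 i as that by (intro nth_equalityI)
            (auto simp: con_def nth_append nth_list_update nth_Cons split: nat.splits)
        moreover have "free_linear (Mor C) (\<lambda>x. f ((con i as)[i - 1 := ?m (as ! (i - 1)) x]))"
          using free_linear_compose [OF _ free_linear_amult_right [of "as ! (i - 1)"],
            of "\<lambda>x. f ((con i as)[i - 1 := x])"] nth i 3
            hh_cochains_linear [OF f, of "con i as" "i - 1"] con_set [OF as i] by auto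
        ultimately show ?thesis
          using 3 by (simp add: p_def)
      next
        case 4
        have "con i (as[j := x]) = (con i as)[p := x]" for x
        proof -
          obtain k where "j = Suc (i + k)"
            using 4 less_iff_Suc_add by auto
          moreover have "i + k - min (Suc n) (i - Suc 0) = Suc k" "\<not> i + k < i - Suc 0"
            using i by auto
          ultimately show ?thesis
            using i as by (simp add: con_def p_def drop_update_swap list_update_append)
        qed
        then show ?thesis
          using lin by simp
      qed
    qed
    show "free_linear (Mor C) (\<lambda>x. hh_differential C n f (as[j := x]))"
    proof (rule free_linear_eq_on)
      show "free_linear (Mor C) (\<lambda>x. ?m (hd (as[j := x])) (f (tl (as[j := x])))
          + (\<Sum>i = 1..n. free_scale ((- 1) ^ i) (f (con i (as[j := x]))))
          + free_scale ((- 1) ^ Suc n) (?m (f (butlast (as[j := x]))) (last (as[j := x]))))"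
        by (intro free_linear_add free_linear_sum free_linear_scale first last middle)
    qed (use unfold upd in blast)
  }
qed (auto simp: hochschild_differential_def)

section \<open>Cochains as tables of coefficients at words of morphisms\<close>

lemma hh_cochains_eqI:
  assumes f: "f \<in> hh_cochains C n" and g: "g \<in> hh_cochains C n"
    and eq: "\<And>gs. length gs = n \<Longrightarrow> set gs \<subseteq> Mor C \<Longrightarrow> f (map basis gs) = g (map basis gs)"
  shows "f = g"
proof
  fix as
  \<comment> \<open>\<open>k\<close> counts the leading slots that may be arbitrary; expanding the
    last of them in the basis lowers it by one.\<close>
  have *: "f as = g as" if "length as = n" "set as \<subseteq> free_space (Mor C)" "k \<le> n"
    "\<forall>i. k \<le> i \<longrightarrow> i < n \<longrightarrow> (\<exists>x \<in> Mor C. as ! i = basis x)" for k as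
    using that
  proof (induction k arbitrary: as)
    case 0
    then obtain x where x: "x i \<in> Mor C \<and> as ! i = basis (x i)" if "i < n" for i
      by (metis le0)
    then have "as = map basis (map x [0..<n])"
      using 0 by (intro nth_equalityI) auto
    moreover have "set (map x [0..<n]) \<subseteq> Mor C"
      using x by auto
    ultimately show ?case
      using eq [of "map x [0..<n]"] by simp
  next
    case (Suc k)
    have "as ! k \<in> free_space (Mor C)" "k < n"
      using Suc.prems nth_mem [of k as] by auto
    note expand = linear_between_free_expand [OF hh_cochains_linear [OF _ Suc.prems(1,2) this(2)] this(1)]
    have "f (as[k := basis x]) = g (as[k := basis x])" if "x \<in> Poly_Mapping.keys (as ! k)" for x
    proof (rule Suc.IH)
      have x: "x \<in> Mor C"
        using \<open>as ! k \<in> free_space (Mor C)\<close> that by (auto simp: free_space_def)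
      then show "set (as[k := basis x]) \<subseteq> free_space (Mor C)"
        using Suc.prems set_update_subset_insert [of as k "basis x"] by auto
      show "\<forall>i. k \<le> i \<longrightarrow> i < n \<longrightarrow> (\<exists>y \<in> Mor C. as[k := basis x] ! i = basis y)"
        using Suc.prems x by (auto simp: nth_list_update)
    qed (use Suc.prems in auto)
    then show ?case
      using expand [OF f] expand [OF g] by simp
  qed
  show "f as = g as"
    by (cases "length as = n \<and> set as \<subseteq> free_space (Mor C)")
       (auto simp: * [of as n] hh_cochains_outside [OF f] hh_cochains_outside [OF g])
qed

definition coeff :: "(('m \<Rightarrow>\<^sub>0 'k::field) list \<Rightarrow> ('m \<Rightarrow>\<^sub>0 'k)) \<Rightarrow> 'm list \<Rightarrow> 'm \<Rightarrow> 'k" where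
  "coeff f gs h = Poly_Mapping.lookup (f (map basis gs)) h"

lemma coeff_add: "coeff (f + g) gs h = coeff f gs h + coeff g gs h"
  by (simp add: coeff_def lookup_add)

lemma hh_cochains_eqI_coeff:
  assumes f: "f \<in> hh_cochains C n" and g: "g \<in> hh_cochains C n"
    and eq: "\<And>gs h. length gs = n \<Longrightarrow> set gs \<subseteq> Mor C \<Longrightarrow> h \<in> Mor C \<Longrightarrow> coeff f gs h = coeff g gs h"
  shows "f = g"
proof (rule hh_cochains_eqI [OF f g], rule poly_mapping_eqI)
  fix gs h assume gs: "length gs = n" "set gs \<subseteq> Mor C"
  then have "set (map basis gs) \<subseteq> free_space (Mor C)"
    by auto
  then have "f (map basis gs) \<in> free_space (Mor C)" "g (map basis gs) \<in> free_space (Mor C)"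
    using hh_cochains_mem f g gs by (metis length_map)+
  then show "Poly_Mapping.lookup (f (map basis gs)) h = Poly_Mapping.lookup (g (map basis gs)) h"
    using eq [OF gs, of h] by (cases "h \<in> Mor C") (auto simp: coeff_def mem_free_space_iff)
qed

text \<open>The multilinear extension of a table in which \<open>c gs h\<close> is the coefficient
  of \<open>h\<close> at the word \<open>gs\<close>. It is meant for finitely many morphisms, where
  both sums are finite.\<close>

definition cochain_of :: "('o, 'm) cat \<Rightarrow> nat \<Rightarrow> ('m list \<Rightarrow> 'm \<Rightarrow> 'k::field)
    \<Rightarrow> (('m \<Rightarrow>\<^sub>0 'k) list \<Rightarrow> ('m \<Rightarrow>\<^sub>0 'k))" where
  "cochain_of C n c as = (if length as = n \<and> set as \<subseteq> free_space (Mor C)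
    then \<Sum>gs | set gs \<subseteq> Mor C \<and> length gs = n. \<Sum>h \<in> Mor C.
      Poly_Mapping.single h ((\<Prod>i<n. Poly_Mapping.lookup (as ! i) (gs ! i)) * c gs h)
    else 0)"

context finite_category
begin

lemma lookup_cochain_of:
  assumes "length as = n" "set as \<subseteq> free_space (Mor C)" "h \<in> Mor C"
  shows "Poly_Mapping.lookup (cochain_of C n c as) h =
    (\<Sum>gs | set gs \<subseteq> Mor C \<and> length gs = n.
      (\<Prod>i<n. Poly_Mapping.lookup (as ! i) (gs ! i)) * c gs h)"
  using assms finite_Mor by (simp add: cochain_of_def lookup_sum lookup_single when_def)

lemma cochain_of_mem: "cochain_of C n c \<in> hh_cochains C n"
proof (rule hh_cochainsI)
  show mem: "cochain_of C n c as \<in> free_space (Mor C)" for as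
    unfolding cochain_of_def by (auto intro!: sum_mem_free_space) (auto simp: free_space_def)
  fix as :: "('b \<Rightarrow>\<^sub>0 'c) list" and j
  assume as: "length as = n" "set as \<subseteq> free_space (Mor C)" and j: "j < n"
  have upd: "length (as[j := x]) = n" "set (as[j := x]) \<subseteq> free_space (Mor C)"
    if "x \<in> free_space (Mor C)" for x
    using as that set_update_subset_insert [of as j x] by auto
  have prod: "(\<Prod>i<n. Poly_Mapping.lookup (as[j := x] ! i) (gs ! i)) = Poly_Mapping.lookup x (gs ! j)
      * (\<Prod>i \<in> {..<n} - {j}. Poly_Mapping.lookup (as ! i) (gs ! i))" for x gs
    using j as by (subst prod.remove [of _ j]) (auto intro!: prod.cong)
  have outside: "Poly_Mapping.lookup (cochain_of C n c x) h = 0" if "h \<notin> Mor C" for x h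
    using mem that by (simp add: mem_free_space_iff)
  have "cochain_of C n c (as[j := x + y])
      = cochain_of C n c (as[j := x]) + cochain_of C n c (as[j := y])"
    if "x \<in> free_space (Mor C)" "y \<in> free_space (Mor C)" for x y
  proof (rule poly_mapping_eqI)
    fix h
    show "Poly_Mapping.lookup (cochain_of C n c (as[j := x + y])) h = Poly_Mapping.lookup
      (cochain_of C n c (as[j := x]) + cochain_of C n c (as[j := y])) h"
      using that by (cases "h \<in> Mor C")
        (simp_all add: lookup_cochain_of as(1) upd prod lookup_add outside algebra_simps sum.distrib
          add_mem_free_space)
  qed
  moreover have "cochain_of C n c (as[j := free_scale d x])
      = free_scale d (cochain_of C n c (as[j := x]))" if "x \<in> free_space (Mor C)" for x d
  proof (rule poly_mapping_eqI)
    fix h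
    show "Poly_Mapping.lookup (cochain_of C n c (as[j := free_scale d x])) h = Poly_Mapping.lookup
      (free_scale d (cochain_of C n c (as[j := x]))) h"
      using that by (cases "h \<in> Mor C")
        (simp_all add: lookup_cochain_of as(1) upd prod outside mult.assoc sum_distrib_left
          free_scale_mem_free_space)
  qed
  ultimately show "free_linear (Mor C) (\<lambda>x. cochain_of C n c (as[j := x]))"
    using mem by (simp add: linear_between_def)
qed (auto simp: cochain_of_def)

lemma coeff_cochain_of:
  assumes gs: "length gs = n" "set gs \<subseteq> Mor C" and h: "h \<in> Mor C"
  shows "coeff (cochain_of C n c) gs h = c gs h"
proof -
  have "set (map basis gs) \<subseteq> free_space (Mor C)"
    using gs by auto
  then have "coeff (cochain_of C n c) gs h = (\<Sum>gs' | set gs' \<subseteq> Mor C \<and> length gs' = n.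
      (\<Prod>i<n. Poly_Mapping.lookup (basis (gs ! i)) (gs' ! i)) * c gs' h)"
    using gs h unfolding coeff_def by (subst lookup_cochain_of) auto
  also have "\<dots> = (\<Sum>gs' | set gs' \<subseteq> Mor C \<and> length gs' = n. if gs' = gs then c gs' h else 0)"
  proof (intro sum.cong refl)
    fix gs' assume gs': "gs' \<in> {gs'. set gs' \<subseteq> Mor C \<and> length gs' = n}"
    show "(\<Prod>i<n. Poly_Mapping.lookup (basis (gs ! i)) (gs' ! i)) * c gs' h
      = (if gs' = gs then c gs' h else 0)"
    proof (cases "gs' = gs")
      case False
      then obtain i where "i < n" "gs ! i \<noteq> gs' ! i"
        using gs gs' by (metis (mono_tags, lifting) mem_Collect_eq nth_equalityI)
      then have "(\<Prod>i<n. Poly_Mapping.lookup (basis (gs ! i)) (gs' ! i) :: 'c) = 0"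
        by (intro prod_zero) (auto simp: lookup_single when_def)
      with False show ?thesis
        by simp
    qed simp
  qed
  also have "\<dots> = c gs h"
    using gs finite_lists_length_eq [OF finite_Mor, of n] by simp
  finally show ?thesis .
qed

end

section \<open>The Hochschild differential in coordinates\<close>

text \<open>These are the inner Hochschild terms; each step down the word contributes one minus
  sign. The recursion on words runs parallel to that of \<open>gap\<close>, so that the two can be
  interchanged by induction.\<close>

fun merge_sum :: "('o, 'm) cat \<Rightarrow> ('m list \<Rightarrow> 'k::field) \<Rightarrow> 'm list \<Rightarrow> 'k" where
  "merge_sum C \<phi> (g # g' # gs) =
    - (if Src C g = Tgt C g' then \<phi> (Cmp C g g' # gs) else 0)
    - merge_sum C (\<lambda>l. \<phi> (g # l)) (g' # gs)"
| "merge_sum C \<phi> _ = 0"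

text \<open>If \<open>c\<close> holds the coefficients of a cochain, this is the coefficient of
  \<open>h\<close> in the outer left term of its differential.\<close>

definition left_sum :: "('o, 'm) cat \<Rightarrow> ('m list \<Rightarrow> 'm \<Rightarrow> 'k::field) \<Rightarrow> 'm list \<Rightarrow> 'm \<Rightarrow> 'k" where
  "left_sum C c gs h =
    (\<Sum>h' | h' \<in> Mor C \<and> Src C (hd gs) = Tgt C h' \<and> Cmp C (hd gs) h' = h. c (tl gs) h')"

definition right_sum :: "('o, 'm) cat \<Rightarrow> ('m list \<Rightarrow> 'm \<Rightarrow> 'k::field) \<Rightarrow> 'm list \<Rightarrow> 'm \<Rightarrow> 'k" where
  "right_sum C c gs h =
    (\<Sum>h' | h' \<in> Mor C \<and> Src C h' = Tgt C (last gs) \<and> Cmp C h' (last gs) = h. c (butlast gs) h')"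

definition coeff_differential ::
  "('o, 'm) cat \<Rightarrow> ('m list \<Rightarrow> 'm \<Rightarrow> 'k::field) \<Rightarrow> 'm list \<Rightarrow> 'm \<Rightarrow> 'k" where
  "coeff_differential C c gs h =
    left_sum C c gs h + merge_sum C (\<lambda>l. c l h) gs + (- 1) ^ length gs * right_sum C c gs h"

lemma merge_sum_eq_sum:
  fixes \<phi> :: "'m list \<Rightarrow> 'k::field"
  assumes "length gs = Suc n"
  shows "merge_sum C \<phi> gs = (\<Sum>i = 1..n. (- 1) ^ i *
    (if Src C (gs ! (i - 1)) = Tgt C (gs ! i)
     then \<phi> (take (i - 1) gs @ Cmp C (gs ! (i - 1)) (gs ! i) # drop (Suc i) gs) else 0))"
  using assms
proof (induction C \<phi> gs arbitrary: n rule: merge_sum.induct)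
  case (1 C \<phi> g g' gs)
  then obtain m where m: "n = Suc m" "length (g' # gs) = Suc m"
    by (cases n) auto
  have split: "(\<Sum>i = 1..Suc m. F i) = F 1 + (\<Sum>i = 1..m. F (Suc i))" for F :: "nat \<Rightarrow> 'k"
    using sum.atLeast_Suc_atMost [of 1 "Suc m" F] sum.shift_bounds_cl_Suc_ivl [of F 1 m]
    by (simp del: sum.cl_ivl_Suc)
  let ?F = "\<lambda>\<phi> gs i. (- 1) ^ i * (if Src C (gs ! (i - 1)) = Tgt C (gs ! i)
     then \<phi> (take (i - 1) gs @ Cmp C (gs ! (i - 1)) (gs ! i) # drop (Suc i) gs) else 0)"
  have "(\<Sum>i = 1..n. ?F \<phi> (g # g' # gs) i)
    = ?F \<phi> (g # g' # gs) 1 + (\<Sum>i = 1..m. ?F \<phi> (g # g' # gs) (Suc i))"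
    unfolding m by (rule split)
  also have "(\<Sum>i = 1..m. ?F \<phi> (g # g' # gs) (Suc i)) = - (\<Sum>i = 1..m. ?F (\<lambda>l. \<phi> (g # l)) (g' # gs) i)"
    unfolding sum_negf [symmetric]
  proof (intro sum.cong refl)
    fix i assume "i \<in> {1..m}"
    then obtain j where "i = Suc j"
      by (cases i) auto
    then show "?F \<phi> (g # g' # gs) (Suc i) = - ?F (\<lambda>l. \<phi> (g # l)) (g' # gs) i"
      by simp
  qed
  finally show ?case
    using "1.IH" [OF m(2)] by simp
qed auto

text \<open>Linearity in one slot suffices. The case that matters is a contracted slot holding the
  product of two morphisms that do not compose.\<close>

lemma hh_cochains_zero_arg:
  assumes f: "f \<in> hh_cochains C n" and "0 \<in> set as"
  shows "f as = 0"
proof (cases "length as = n \<and> set as \<subseteq> free_space (Mor C)")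
  case True
  obtain i where "i < n" "as ! i = 0"
    using assms(2) True by (auto simp: in_set_conv_nth)
  moreover have "as[i := 0] = as"
    using list_update_id [of as i] \<open>as ! i = 0\<close> by simp
  ultimately show ?thesis
    using linear_between_free_expand [OF hh_cochains_linear [OF f], of as i 0] True by simp
qed (use f in \<open>auto intro: hh_cochains_outside\<close>)

lemma (in finite_category) coeff_hh_differential:
  fixes f :: "('b \<Rightarrow>\<^sub>0 'k::field) list \<Rightarrow> ('b \<Rightarrow>\<^sub>0 'k)"
  assumes f: "f \<in> hh_cochains C n" and gs: "length gs = Suc n" "set gs \<subseteq> Mor C"
  shows "coeff (hh_differential C n f) gs h = coeff_differential C (coeff f) gs h"
proof -
  let ?b = "map basis gs :: ('b \<Rightarrow>\<^sub>0 'k) list"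
  have ne: "gs \<noteq> []"
    using gs by auto
  have b: "length ?b = Suc n" "set ?b \<subseteq> free_space (Mor C)"
    using gs by auto
  have "set (tl ?b) \<subseteq> free_space (Mor C)" "set (butlast ?b) \<subseteq> free_space (Mor C)"
    using b(2) ne in_set_butlastD [of _ ?b] list.set_sel(2) [of ?b] by blast+
  then have mem: "f (tl ?b) \<in> free_space (Mor C)" "f (butlast ?b) \<in> free_space (Mor C)"
    using gs(1) by (auto intro!: hh_cochains_mem [OF f])
  have "coeff (hh_differential C n f) gs h
    = Poly_Mapping.lookup (amult (category_algebra C) (hd ?b) (f (tl ?b))) h
      + (\<Sum>i = 1..n. (- 1) ^ i * Poly_Mapping.lookup
          (f (take (i - 1) ?b @ amult (category_algebra C) (?b ! (i - 1)) (?b ! i) # drop (Suc i) ?b)) h)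
      + (- 1) ^ Suc n * Poly_Mapping.lookup (amult (category_algebra C) (f (butlast ?b)) (last ?b)) h"
  proof -
    have *: "length ?b = Suc n \<and> set ?b \<subseteq> acarrier (category_algebra C)"
      using b by simp
    show ?thesis
      unfolding coeff_def hochschild_differential_def if_P [OF *]
      by (simp add: lookup_add lookup_sum)
  qed
  also have "Poly_Mapping.lookup (amult (category_algebra C) (hd ?b) (f (tl ?b))) h = left_sum C (coeff f) gs h"
    using lookup_amult_basis_left [OF mem(1), of "hd gs"] ne
    by (simp add: left_sum_def hd_map coeff_def map_tl)
  also have "Poly_Mapping.lookup (amult (category_algebra C) (f (butlast ?b)) (last ?b)) h
    = right_sum C (coeff f) gs h"
    using lookup_amult_basis_right [OF mem(2), of "last gs"] ne
    by (simp add: right_sum_def last_map coeff_def map_butlast)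
  also have "(\<Sum>i = 1..n. (- 1) ^ i * Poly_Mapping.lookup
      (f (take (i - 1) ?b @ amult (category_algebra C) (?b ! (i - 1)) (?b ! i) # drop (Suc i) ?b)) h)
    = merge_sum C (\<lambda>l. coeff f l h) gs"
    unfolding merge_sum_eq_sum [OF gs(1)]
  proof (intro sum.cong refl arg_cong2 [where f = "(*)"])
    fix i assume "i \<in> {1..n}"
    then have "?b ! (i - 1) = basis (gs ! (i - 1))" "?b ! i = basis (gs ! i)"
      using gs by auto
    then show "Poly_Mapping.lookup
      (f (take (i - 1) ?b @ amult (category_algebra C) (?b ! (i - 1)) (?b ! i) # drop (Suc i) ?b)) h
      = (if Src C (gs ! (i - 1)) = Tgt C (gs ! i)
         then coeff f (take (i - 1) gs @ Cmp C (gs ! (i - 1)) (gs ! i) # drop (Suc i) gs) h else 0)"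
      by (simp add: amult_basis_basis coeff_def take_map drop_map hh_cochains_zero_arg [OF f])
  qed
  finally show ?thesis
    using gs by (simp add: coeff_differential_def)
qed

section \<open>Contracting the non-cyclic part\<close>

fun is_path :: "('o, 'm) cat \<Rightarrow> 'o \<Rightarrow> 'm list \<Rightarrow> 'o \<Rightarrow> bool" where
  "is_path C y [] x \<longleftrightarrow> x = y \<and> x \<in> Obj C"
| "is_path C y (g # gs) x \<longleftrightarrow> g \<in> Mor C \<and> Tgt C g = y \<and> is_path C (Src C g) gs x"

text \<open>Reading \<open>gs\<close> from the object \<open>y\<close> towards \<open>z\<close>, insert an identity at the first place where
  consecutive source and target disagree, with the sign of that position.\<close>

fun gap :: "('o, 'm) cat \<Rightarrow> 'o \<Rightarrow> ('m list \<Rightarrow> 'k::field) \<Rightarrow> 'o \<Rightarrow> 'm list \<Rightarrow> 'k" where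
  "gap C z \<phi> y [] = (if y = z then 0 else \<phi> [Idm C y])"
| "gap C z \<phi> y (g # gs) = (if Tgt C g = y then - gap C z (\<lambda>l. \<phi> (g # l)) (Src C g) gs
     else \<phi> (Idm C y # g # gs))"

definition gap_homotopy ::
  "('o, 'm) cat \<Rightarrow> ('m list \<Rightarrow> 'm \<Rightarrow> 'k::field) \<Rightarrow> 'm list \<Rightarrow> 'm \<Rightarrow> 'k" where
  "gap_homotopy C c gs h = gap C (Src C h) (\<lambda>l. c l h) (Tgt C h) gs"

lemma gap_cong:
  "(\<And>l. length l = Suc (length gs) \<Longrightarrow> \<phi> l = \<psi> l) \<Longrightarrow> gap C z \<phi> y gs = gap C z \<psi> y gs"
proof (induction gs arbitrary: y \<phi> \<psi>)
  case (Cons g gs)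
  have "gap C z (\<lambda>l. \<phi> (g # l)) (Src C g) gs = gap C z (\<lambda>l. \<psi> (g # l)) (Src C g) gs"
    by (rule Cons.IH) (simp add: Cons.prems)
  then show ?case
    by (simp add: Cons.prems)
qed simp

lemma gap_add: "gap C z (\<lambda>l. \<phi> l + \<psi> l) y gs = gap C z \<phi> y gs + gap C z \<psi> y gs"
  by (induction gs arbitrary: y \<phi> \<psi>) auto

lemma gap_scale: "gap C z (\<lambda>l. a * \<phi> l) y gs = a * gap C z \<phi> y gs"
  by (induction gs arbitrary: y \<phi>) auto

lemma gap_minus: "gap C z (\<lambda>l. - \<phi> l) y gs = - gap C z \<phi> y gs"
  using gap_scale [of C z "- 1"] by simp

lemma gap_zero: "gap C z (\<lambda>l. 0) y gs = 0"
  using gap_scale [of C z 0] by simp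

lemma gap_sum: "gap C z (\<lambda>l. \<Sum>i \<in> I. \<phi> i l) y gs = (\<Sum>i \<in> I. gap C z (\<phi> i) y gs)"
  by (induction I rule: infinite_finite_induct) (simp_all add: gap_zero gap_add)

lemma merge_sum_minus: "merge_sum C (\<lambda>l. - \<phi> l) gs = - merge_sum C \<phi> gs"
  by (induction C \<phi> gs rule: merge_sum.induct) auto

context category
begin

text \<open>The scan starts at an object and goes on at sources of morphisms, so the inserted
  identity is a morphism and \<open>\<phi>\<close> is only evaluated at words of morphisms.\<close>

lemma gap_cong_Mor:
  assumes "y \<in> Obj C" "set gs \<subseteq> Mor C"
    and "\<And>l. length l = Suc (length gs) \<Longrightarrow> set l \<subseteq> Mor C \<Longrightarrow> \<phi> l = \<psi> l"
  shows "gap C z \<phi> y gs = gap C z \<psi> y gs"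
  using assms
proof (induction gs arbitrary: y \<phi> \<psi>)
  case (Cons g gs)
  have "gap C z (\<lambda>l. \<phi> (g # l)) (Src C g) gs = gap C z (\<lambda>l. \<psi> (g # l)) (Src C g) gs"
    by (rule Cons.IH) (use Cons.prems Src_in_Obj in auto)
  then show ?case
    using Cons.prems by (simp add: Idm_in_Mor)
qed (simp add: Idm_in_Mor)

text \<open>The assumption says that an entry satisfying \<open>\<rho>\<close> leads from
  \<open>z\<close> to \<open>w\<close>. Scanning towards \<open>z\<close> and then splitting off the
  last entry is therefore the same as splitting it off and scanning towards \<open>w\<close>. An
  identity inserted at the very end violates \<open>\<rho>\<close>, as it is inserted only if its
  object differs from \<open>z\<close>.\<close>

lemma gap_right:
  assumes "y \<in> Obj C" "set gs \<subseteq> Mor C" "\<And>m. \<rho> m \<Longrightarrow> Src C m = z \<and> Tgt C m = w"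
  shows "gap C z (\<lambda>l. if \<rho> (last l) then \<phi> (butlast l) else 0) y gs
    = (if gs \<noteq> [] \<and> \<rho> (last gs) then gap C w \<phi> y (butlast gs) else 0)"
  using assms(1,2)
proof (induction gs arbitrary: y \<phi>)
  case Nil
  then show ?case
    using assms(3) [of "Idm C y"] Src_Idm [of y] by auto
next
  case (Cons g gs)
  show ?case
  proof (cases "Tgt C g = y")
    case True
    have "gap C z (\<lambda>l. if \<rho> (last l) then \<phi> (butlast l) else 0) y (g # gs)
      = - gap C z (\<lambda>l. if \<rho> (last l) then \<phi> (g # butlast l) else 0) (Src C g) gs"
      using True by (auto intro!: gap_cong)
    also have "\<dots> = - (if gs \<noteq> [] \<and> \<rho> (last gs)
        then gap C w (\<lambda>l. \<phi> (g # l)) (Src C g) (butlast gs) else 0)"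
      using Cons.IH [of "Src C g" "\<lambda>l. \<phi> (g # l)"] Cons.prems Src_in_Obj by simp
    finally show ?thesis
      using True assms(3) [of g] by auto
  qed (use assms(3) in auto)
qed

text \<open>If the break is at the front, the inserted identity is multiplied onto the value and
  gives back \<open>c gs h\<close>. If the first entry fits, both summands scan the same tail, and
  they cancel by the minus sign with which \<open>gap\<close> passes an entry.\<close>

lemma gap_left_sum:
  fixes c :: "'m list \<Rightarrow> 'm \<Rightarrow> 'k::field"
  assumes "h \<in> Mor C" "set gs \<subseteq> Mor C"
  shows "gap C (Src C h) (\<lambda>l. left_sum C c l h) (Tgt C h) gs
    + (if gs = [] then 0 else left_sum C (gap_homotopy C c) gs h)
    = (if (case gs of [] \<Rightarrow> Src C h \<noteq> Tgt C h | g # _ \<Rightarrow> Tgt C g \<noteq> Tgt C h) then c gs h else 0)"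
proof -
  have id: "{h'. h' \<in> Mor C \<and> Src C (Idm C (Tgt C h)) = Tgt C h' \<and> Cmp C (Idm C (Tgt C h)) h' = h}
      = {h}"
  proof -
    have "Src C (Idm C (Tgt C h)) = Tgt C h"
      using assms(1) by (simp add: Src_Idm Tgt_in_Obj)
    moreover have "h' = h"
      if "h' \<in> Mor C" "Tgt C h = Tgt C h'" "Cmp C (Idm C (Tgt C h)) h' = h" for h'
      using Cmp_Idm_Tgt [OF that(1)] that(3) unfolding that(2) by (rule trans [OF sym])
    ultimately show ?thesis
      using Cmp_Idm_Tgt [OF assms(1)] assms(1)
      by (intro set_eqI iffI; elim CollectE conjE singletonE) (simp_all only: singleton_iff mem_Collect_eq simp_thms)
  qed
  have left_Idm: "left_sum C c (Idm C (Tgt C h) # l) h = c l h" for l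
    unfolding left_sum_def list.sel id by simp
  show ?thesis
  proof (cases gs)
    case Nil
    then show ?thesis
      using left_Idm [of "[]"] by simp
  next
    case (Cons g gs')
    let ?H = "{h'. h' \<in> Mor C \<and> Src C g = Tgt C h' \<and> Cmp C g h' = h}"
    \<comment> \<open>A factor \<open>h'\<close> starts where \<open>h\<close> starts and ends at
      the source of \<open>g\<close>. So the scan for \<open>h'\<close> is the scan for
      \<open>h\<close> after \<open>g\<close> has been passed.\<close>
    have H: "Tgt C g = Tgt C h \<and> Src C h' = Src C h \<and> Tgt C h' = Src C g" if "h' \<in> ?H" for h'
      using that Tgt_Cmp [of h' g] Src_Cmp [of h' g] assms Cons by auto
    show ?thesis
    proof (cases "Tgt C g = Tgt C h")
      case True
      have "(\<Sum>h' \<in> ?H. gap C (Src C h') (\<lambda>l. c l h') (Tgt C h') gs')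
        = (\<Sum>h' \<in> ?H. gap C (Src C h) (\<lambda>l. c l h') (Src C g) gs')"
      proof (intro sum.cong refl)
        fix h' assume "h' \<in> ?H"
        from H [OF this]
        show "gap C (Src C h') (\<lambda>l. c l h') (Tgt C h') gs' = gap C (Src C h) (\<lambda>l. c l h') (Src C g) gs'"
          by simp
      qed
      then show ?thesis
        using True Cons by (simp add: left_sum_def gap_homotopy_def gap_sum)
    next
      case False
      then have "?H = {}"
        using H by blast
      have "left_sum C c' gs h = 0" for c' :: "'m list \<Rightarrow> 'm \<Rightarrow> 'k"
        unfolding left_sum_def Cons list.sel \<open>?H = {}\<close> by simp
      then show ?thesis
        using False Cons left_Idm [of gs] by simp
    qed
  qed
qed

text \<open>No product changes the target of the first entry. Hence a scan that breaks before the
  first entry does so for every contracted word as well.\<close>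

lemma merge_sum_cong:
  assumes "set (g # gs) \<subseteq> Mor C"
    and "\<And>k ks. k \<in> Mor C \<Longrightarrow> Tgt C k = Tgt C g \<Longrightarrow> \<phi> (k # ks) = \<psi> (k # ks)"
  shows "merge_sum C \<phi> (g # gs) = merge_sum C \<psi> (g # gs)"
proof (cases gs)
  case (Cons g' gs')
  have "merge_sum C (\<lambda>l. \<phi> (g # l)) (g' # gs') = merge_sum C (\<lambda>l. \<psi> (g # l)) (g' # gs')"
    using assms by (intro arg_cong [where f = "\<lambda>\<phi>. merge_sum C \<phi> (g' # gs')"]) auto
  then show ?thesis
    using Cons assms(1) assms(2) [of "Cmp C g g'"] Cmp_in_Mor [of g' g] Tgt_Cmp [of g' g] by simp
qed simp

text \<open>Of the products involving the inserted identity, the one with the entry before it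
  restores \<open>gs\<close>; the one with the entry after it vanishes, since the objects disagree
  at a break. All other products occur in both summands with opposite signs. A break at the front
  has no entry before it, and a path has no break.\<close>

lemma gap_merge_sum:
  assumes "y \<in> Obj C" "set gs \<subseteq> Mor C"
  shows "gap C z (merge_sum C \<phi>) y gs + merge_sum C (gap C z \<phi> y) gs
    = (if (case gs of [] \<Rightarrow> True | g # _ \<Rightarrow> Tgt C g \<noteq> y) \<or> is_path C y gs z then 0 else \<phi> gs)"
  using assms
proof (induction gs arbitrary: y \<phi>)
  case (Cons g gs)
  then have g: "g \<in> Mor C" "Src C g \<in> Obj C"
    using Src_in_Obj by auto
  show ?case
  proof (cases "Tgt C g = y")
    case False
    have "merge_sum C (gap C z \<phi> y) (g # gs) = merge_sum C (\<lambda>l. \<phi> (Idm C y # l)) (g # gs)"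
      using False Cons.prems by (intro merge_sum_cong) auto
    then show ?thesis
      using False Cons.prems Src_Idm by simp
  next
    case True
    \<comment> \<open>\<open>J\<close> is the product of \<open>g\<close> with the entry after it.
      Once it is split off, the induction hypothesis for the tail covers the rest.\<close>
    define J where "J l = (if Src C g = Tgt C (hd l) then \<phi> (Cmp C g (hd l) # tl l) else 0)" for l
    have "gap C z (\<lambda>l. merge_sum C \<phi> (g # l)) (Src C g) gs
      = gap C z (\<lambda>l. - (J l + merge_sum C (\<lambda>l. \<phi> (g # l)) l)) (Src C g) gs"
    proof (rule gap_cong)
      fix l :: "'m list" assume "length l = Suc (length gs)"
      then show "merge_sum C \<phi> (g # l) = - (J l + merge_sum C (\<lambda>l. \<phi> (g # l)) l)"
        by (cases l) (simp_all add: J_def)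
    qed
    then have gap: "gap C z (merge_sum C \<phi>) y (g # gs)
      = gap C z J (Src C g) gs + gap C z (merge_sum C (\<lambda>l. \<phi> (g # l))) (Src C g) gs"
      using True by (simp only: gap.simps if_True gap_minus gap_add minus_minus simp_thms)
    show ?thesis
    proof (cases gs)
      case Nil
      then show ?thesis
        using gap True g by (simp add: J_def Tgt_Idm Cmp_Idm_Src)
    next
      case k: (Cons k ks)
      have "merge_sum C (\<lambda>l. gap C z \<phi> y (g # l)) gs
        = - merge_sum C (gap C z (\<lambda>l. \<phi> (g # l)) (Src C g)) gs"
        using True by (simp add: merge_sum_minus)
      then have merge: "merge_sum C (gap C z \<phi> y) (g # gs)
        = - (if Src C g = Tgt C k then gap C z \<phi> y (Cmp C g k # ks) else 0)
          + merge_sum C (gap C z (\<lambda>l. \<phi> (g # l)) (Src C g)) gs"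
        using k by simp
      have "k \<in> Mor C"
        using Cons.prems k by simp
      \<comment> \<open>If \<open>k\<close> fits after \<open>g\<close>, the two products of
        \<open>g\<close> with its neighbour cancel. At a break, only the product of \<open>g\<close>
        with the inserted identity is left, which is \<open>g\<close>.\<close>
      then have J: "gap C z J (Src C g) gs
          - (if Src C g = Tgt C k then gap C z \<phi> y (Cmp C g k # ks) else 0)
        = (if Tgt C k = Src C g then 0 else \<phi> (g # gs))"
        using True g k Src_Cmp [of k g] Tgt_Cmp [of k g]
        by (auto simp: J_def Tgt_Idm Cmp_Idm_Src)
      have "gap C z (merge_sum C \<phi>) y (g # gs) + merge_sum C (gap C z \<phi> y) (g # gs)
        = (gap C z J (Src C g) gs - (if Src C g = Tgt C k then gap C z \<phi> y (Cmp C g k # ks) else 0))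
          + (gap C z (merge_sum C (\<lambda>l. \<phi> (g # l))) (Src C g) gs
            + merge_sum C (gap C z (\<lambda>l. \<phi> (g # l)) (Src C g)) gs)"
        unfolding gap merge by simp
      also have "\<dots> = (if Tgt C k = Src C g then 0 else \<phi> (g # gs))
          + (if Tgt C k \<noteq> Src C g \<or> is_path C (Src C g) gs z then 0 else \<phi> (g # gs))"
        unfolding J using Cons.IH [of "Src C g" "\<lambda>l. \<phi> (g # l)"] Cons.prems g k by simp
      finally show ?thesis
        using True g k by auto
    qed
  qed
qed auto

end

context finite_category
begin

lemma gap_right_sum:
  assumes "h \<in> Mor C" "set gs \<subseteq> Mor C"
  shows "gap C (Src C h) (\<lambda>l. right_sum C c l h) (Tgt C h) gs
    = (if gs = [] then 0 else right_sum C (gap_homotopy C c) gs h)"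
proof -
  \<comment> \<open>\<open>\<rho> h' m\<close> says that \<open>h\<close> factors as
    \<open>h' \<circ> m\<close>. A sum over all \<open>h'\<close> with a condition, unlike one over
    a set depending on the word, lets \<open>gap\<close> move inside.\<close>
  define \<rho> where "\<rho> h' m \<longleftrightarrow> m \<in> Mor C \<and> Src C h' = Tgt C m \<and> Cmp C h' m = h" for h' m
  define R where "R c' = (\<lambda>l. \<Sum>h' \<in> Mor C. if \<rho> h' (last l) then c' (butlast l) h' else 0)"
    for c' :: "'b list \<Rightarrow> 'b \<Rightarrow> 'c"
  have R: "right_sum C c' l h = R c' l" if "last l \<in> Mor C" for l c'
    unfolding right_sum_def R_def using that finite_Mor
    by (subst sum.inter_filter [symmetric]) (auto simp: \<rho>_def intro: sum.cong)
  have \<rho>: "Src C m = Src C h \<and> Tgt C m = Src C h' \<and> Tgt C h' = Tgt C h"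
    if "\<rho> h' m" "h' \<in> Mor C" for h' m
    using that Src_Cmp [of m h'] Tgt_Cmp [of m h'] by (auto simp: \<rho>_def)
  have gap_R: "gap C (Src C h) (\<lambda>l. right_sum C c l h) (Tgt C h) gs
    = gap C (Src C h) (R c) (Tgt C h) gs"
  proof (rule gap_cong_Mor)
    fix l :: "'b list" assume "length l = Suc (length gs)" "set l \<subseteq> Mor C"
    then show "right_sum C c l h = R c l"
      by (intro R) (use last_in_set [of l] in fastforce)
  qed (use assms Tgt_in_Obj in auto)
  have "gap C (Src C h) (R c) (Tgt C h) gs = (\<Sum>h' \<in> Mor C.
      gap C (Src C h) (\<lambda>l. if \<rho> h' (last l) then c (butlast l) h' else 0) (Tgt C h) gs)"
    unfolding R_def by (rule gap_sum)
  also have "\<dots> = (\<Sum>h' \<in> Mor C. if gs \<noteq> [] \<and> \<rho> h' (last gs)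
      then gap C (Src C h') (\<lambda>l. c l h') (Tgt C h) (butlast gs) else 0)"
  proof (intro sum.cong refl)
    fix h' assume "h' \<in> Mor C"
    then show "gap C (Src C h) (\<lambda>l. if \<rho> h' (last l) then c (butlast l) h' else 0) (Tgt C h) gs
      = (if gs \<noteq> [] \<and> \<rho> h' (last gs)
         then gap C (Src C h') (\<lambda>l. c l h') (Tgt C h) (butlast gs) else 0)"
      using assms Tgt_in_Obj \<rho> by (intro gap_right) auto
  qed
  also have "\<dots> = (if gs = [] then 0 else R (gap_homotopy C c) gs)"
    unfolding R_def gap_homotopy_def using \<rho> by (auto intro!: sum.cong)
  also have "\<dots> = (if gs = [] then 0 else right_sum C (gap_homotopy C c) gs h)"
    using R [of gs] subsetD [OF assms(2) last_in_set] by simp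
  finally show ?thesis
    using gap_R assms Tgt_in_Obj by simp
qed

text \<open>The outer right terms of the two composites agree up to sign, as \<open>gap\<close>
  evaluates at words one entry longer, and they cancel. At a break \<open>c gs h\<close> then
  appears exactly once: from the outer left terms if the break is at the front, from the inner terms
  otherwise. The empty word is set apart because no differential arrives in degree 0.\<close>

lemma gap_homotopy_identity:
  assumes "h \<in> Mor C" "set gs \<subseteq> Mor C"
  shows "gap_homotopy C (coeff_differential C c) gs h
    + (if gs = [] then 0 else coeff_differential C (gap_homotopy C c) gs h)
    = (if is_path C (Tgt C h) gs (Src C h) then 0 else c gs h)"
proof -
  have "gap_homotopy C (coeff_differential C c) gs h
    = gap C (Src C h) (\<lambda>l. left_sum C c l h + (merge_sum C (\<lambda>l. c l h) l
        + (- 1) ^ Suc (length gs) * right_sum C c l h)) (Tgt C h) gs"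
    unfolding gap_homotopy_def coeff_differential_def by (rule gap_cong) (simp add: add.assoc)
  also have "\<dots> = gap C (Src C h) (\<lambda>l. left_sum C c l h) (Tgt C h) gs
    + gap C (Src C h) (merge_sum C (\<lambda>l. c l h)) (Tgt C h) gs
    + (- 1) ^ Suc (length gs) * gap C (Src C h) (\<lambda>l. right_sum C c l h) (Tgt C h) gs"
    by (simp only: gap_add gap_scale add.assoc)
  finally have "gap_homotopy C (coeff_differential C c) gs h
    + (if gs = [] then 0 else coeff_differential C (gap_homotopy C c) gs h)
    = (gap C (Src C h) (\<lambda>l. left_sum C c l h) (Tgt C h) gs
       + (if gs = [] then 0 else left_sum C (gap_homotopy C c) gs h))
    + (gap C (Src C h) (merge_sum C (\<lambda>l. c l h)) (Tgt C h) gs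
       + merge_sum C (\<lambda>l. gap_homotopy C c l h) gs)"
    unfolding gap_right_sum [OF assms] by (cases "gs = []") (simp_all add: coeff_differential_def)
  also have "\<dots> = (if (case gs of [] \<Rightarrow> Src C h \<noteq> Tgt C h | g # _ \<Rightarrow> Tgt C g \<noteq> Tgt C h)
      then c gs h else 0)
    + (if (case gs of [] \<Rightarrow> True | g # _ \<Rightarrow> Tgt C g \<noteq> Tgt C h) \<or> is_path C (Tgt C h) gs (Src C h)
       then 0 else c gs h)"
    unfolding gap_left_sum [OF assms] unfolding gap_homotopy_def
    by (rule arg_cong2 [where f = "(+)", OF refl gap_merge_sum [OF Tgt_in_Obj [OF assms(1)] assms(2)]])
  finally show ?thesis
    using assms Src_in_Obj by (cases gs) auto
qed

end

section \<open>Cochains on a nerve\<close>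

definition nerve_cochain_of :: "('o, 'm) cat \<Rightarrow> nat \<Rightarrow> ('o list \<times> 'm list \<Rightarrow> 'k::field)
    \<Rightarrow> (('o list \<times> 'm list \<Rightarrow>\<^sub>0 'k) \<Rightarrow> 'k)" where
  "nerve_cochain_of D n t u = (if u \<in> free_space (nerve D n)
    then \<Sum>x \<in> Poly_Mapping.keys u. Poly_Mapping.lookup u x * t x else 0)"

lemma nerve_cochain_of_mem: "nerve_cochain_of D n t \<in> nerve_cochains D n"
proof -
  let ?X = "nerve D n"
  have sum: "nerve_cochain_of D n t w = (\<Sum>x \<in> I. Poly_Mapping.lookup w x * t x)"
    if "w \<in> free_space ?X" "finite I" "Poly_Mapping.keys w \<subseteq> I" for w I
    using that sum_keys_superset [of I w "\<lambda>x a. a * t x"] by (simp add: nerve_cochain_of_def)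
  have "nerve_cochain_of D n t (u + v) = nerve_cochain_of D n t u + nerve_cochain_of D n t v"
    if "u \<in> free_space ?X" "v \<in> free_space ?X" for u v
  proof -
    let ?I = "Poly_Mapping.keys u \<union> Poly_Mapping.keys v"
    have "finite ?I" "Poly_Mapping.keys (u + v) \<subseteq> ?I"
      by (simp_all add: keys_add)
    then show ?thesis
      using that add_mem_free_space [OF that]
      by (simp add: sum [of _ ?I] lookup_add algebra_simps sum.distrib)
  qed
  moreover have "nerve_cochain_of D n t (free_scale a u) = a * nerve_cochain_of D n t u"
    if "u \<in> free_space ?X" for a u
    using that keys_free_scale_subset [of a u]
    by (simp add: sum [of _ "Poly_Mapping.keys u"] free_scale_mem_free_space sum_distrib_left
        mult.assoc)
  ultimately show ?thesis
    by (auto simp: nerve_cochains_def linear_between_def) (simp add: nerve_cochain_of_def)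
qed

lemma nerve_cochain_of_basis:
  "x \<in> nerve D n \<Longrightarrow> nerve_cochain_of D n t (basis x) = t x"
  by (simp add: nerve_cochain_of_def)

lemma nerve_cochain_of_cong:
  assumes "\<And>x. x \<in> nerve D n \<Longrightarrow> t x = t' x"
  shows "nerve_cochain_of D n t = nerve_cochain_of D n t'"
proof
  fix u
  show "nerve_cochain_of D n t u = nerve_cochain_of D n t' u"
    using assms by (auto simp: nerve_cochain_of_def free_space_def intro!: sum.cong)
qed

lemma nerve_cochains_expand:
  assumes "\<phi> \<in> nerve_cochains D n" "u \<in> free_space (nerve D n)"
  shows "\<phi> u = (\<Sum>x \<in> Poly_Mapping.keys u. Poly_Mapping.lookup u x * \<phi> (basis x))"
  using linear_between_free_expand [of "nerve D n" "(*)" UNIV \<phi> u] assms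
  by (simp add: nerve_cochains_def)

lemma nerve_cochain_of_values:
  assumes "\<phi> \<in> nerve_cochains D n"
  shows "\<phi> = nerve_cochain_of D n (\<lambda>x. \<phi> (basis x))"
proof
  fix u
  show "\<phi> u = nerve_cochain_of D n (\<lambda>x. \<phi> (basis x)) u"
    using assms nerve_cochains_expand [OF assms, of u]
    by (simp add: nerve_cochain_of_def nerve_cochains_def)
qed

lemma subspace_nerve_cochains:
  "module.subspace (\<lambda>c f u. c * f u)
    (nerve_cochains D n :: (('o list \<times> 'm list \<Rightarrow>\<^sub>0 'k::field) \<Rightarrow> 'k) set)"
proof -
  interpret vector_space "\<lambda>c (f :: ('o list \<times> 'm list \<Rightarrow>\<^sub>0 'k) \<Rightarrow> 'k) u. c * f u"
    by (rule vector_space_times_pointwise)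
  show ?thesis
    by (intro subspaceI) (auto simp: nerve_cochains_def linear_between_def algebra_simps)
qed

lemma linear_nerve_differential:
  "Vector_Spaces.linear (\<lambda>c f u. c * f u) (\<lambda>c f u. c * f u)
    (nerve_differential D n :: (('o list \<times> 'm list \<Rightarrow>\<^sub>0 'k::field) \<Rightarrow> 'k) \<Rightarrow> _)"
proof -
  interpret vector_space "\<lambda>c (f :: ('o list \<times> 'm list \<Rightarrow>\<^sub>0 'k) \<Rightarrow> 'k) u. c * f u"
    by (rule vector_space_times_pointwise)
  show ?thesis
    by unfold_locales
      (auto simp: fun_eq_iff nerve_differential_def sum.distrib sum_distrib_left algebra_simps
        simp del: sum.atMost_Suc)
qed

section \<open>Chains, their extension at the end, and their faces\<close>

lemma nerve_snoc:
  "(as @ [b], ts @ [t]) \<in> nerve D (Suc m) \<longleftrightarrow>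
    (as, ts) \<in> nerve D m \<and> b \<in> Obj D \<and> t \<in> Hom D (last as) b"
proof (cases "length as = Suc m \<and> length ts = m")
  case True
  then have "last as = as ! m"
    by (metis diff_Suc_1 last_conv_nth length_0_conv nat.distinct(1))
  moreover have "(\<forall>i < Suc m. (ts @ [t]) ! i \<in> Hom D ((as @ [b]) ! i) ((as @ [b]) ! Suc i)) \<longleftrightarrow>
      t \<in> Hom D (as ! m) b \<and> (\<forall>i < m. ts ! i \<in> Hom D (as ! i) (as ! Suc i))"
    using True by (simp add: All_less_Suc nth_append)
  ultimately show ?thesis
    using True by (auto simp: nerve_def)
qed (auto simp: nerve_def)

lemma nerve_Suc_cases:
  assumes "ch \<in> nerve D (Suc m)"
  obtains as ts b t where "ch = (as @ [b], ts @ [t])" "(as, ts) \<in> nerve D m" "b \<in> Obj D"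
    "t \<in> Hom D (last as) b"
proof -
  obtain as' ts' where ch: "ch = (as', ts')"
    by (cases ch)
  then have "as' \<noteq> []" "ts' \<noteq> []"
    using assms by (auto simp: nerve_def)
  then obtain as b ts t where "as' = as @ [b]" "ts' = ts @ [t]"
    by (metis rev_exhaust)
  then show thesis
    using assms ch that by (simp add: nerve_snoc)
qed

lemma (in category) face_mem_nerve:
  assumes ch: "ch \<in> nerve C (Suc m)" and i: "i \<le> Suc m"
  shows "face C m i ch \<in> nerve C m"
proof -
  obtain as ts where as: "ch = (as, ts)" "length as = Suc (Suc m)" "length ts = Suc m"
      "set as \<subseteq> Obj C" "\<And>j. j < Suc m \<Longrightarrow> ts ! j \<in> Hom C (as ! j) (as ! Suc j)"
    using ch by (auto simp: nerve_def)
  consider "i = 0" | "i = Suc m" | j where "i = Suc j" "j < m"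
    using i by (cases i) (auto simp: le_less)
  then show ?thesis
  proof cases
    case 1
    moreover have "set (tl as) \<subseteq> Obj C"
      using as by (cases as) auto
    ultimately show ?thesis
      using as by (simp add: face_def nerve_def nth_tl)
  next
    case 2
    moreover have "set (butlast as) \<subseteq> Obj C"
      using as by (auto dest: in_set_butlastD)
    ultimately show ?thesis
      using as by (simp add: face_def nerve_def nth_butlast)
  next
    case 3
    have "set (take i as @ drop (Suc i) as) \<subseteq> Obj C"
      using as(4) set_take_subset [of i as] set_drop_subset [of "Suc i" as] by auto
    moreover have "(take (i - 1) ts @ Cmp C (ts ! i) (ts ! (i - 1)) # drop (Suc i) ts) ! l
      \<in> Hom C ((take i as @ drop (Suc i) as) ! l) ((take i as @ drop (Suc i) as) ! Suc l)"
      if "l < m" for l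
    proof -
      \<comment> \<open>Position \<open>j\<close> holds the composite; every later position holds
        what stood one place further along.\<close>
      consider "l < j" | "l = j" | k where "l = Suc (j + k)"
        using less_iff_Suc_add linorder_less_linear by metis
      then show ?thesis
      proof cases
        case 1
        then show ?thesis
          using as(2,3) as(5) [of l] 3 that by (simp add: nth_append)
      next
        case 2
        then show ?thesis
          using as(2,3) as(5) [of j] as(5) [of "Suc j"] 3 that
          by (auto simp: nth_append intro: Cmp_in_Hom)
      next
        case k: 3
        then show ?thesis
          using as(2,3) as(5) [of "Suc l"] 3 that by (simp add: nth_append)
      qed
    qed
    ultimately show ?thesis
      using 3 as by (simp add: face_def nerve_def)
  qed
qed

lemma sum_mult_swap:
  fixes a b :: "_ \<Rightarrow> 'k::comm_semiring_0"
  shows "(\<Sum>i \<in> I. a i * (\<Sum>x \<in> K. b x * c i x)) = (\<Sum>x \<in> K. b x * (\<Sum>i \<in> I. a i * c i x))"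
proof -
  have "(\<Sum>i \<in> I. a i * (\<Sum>x \<in> K. b x * c i x)) = (\<Sum>i \<in> I. \<Sum>x \<in> K. b x * (a i * c i x))"
    by (simp add: sum_distrib_left mult.left_commute)
  also have "\<dots> = (\<Sum>x \<in> K. \<Sum>i \<in> I. b x * (a i * c i x))"
    by (rule sum.swap)
  finally show ?thesis
    by (simp add: sum_distrib_left)
qed

text \<open>A face map may identify chains, but \<open>\<phi>\<close> is linear on the
  pushed-forward combination. Its value is therefore still a sum over the original chains, and the
  alternating sum can be taken chain by chain.\<close>

lemma (in category) nerve_differential_eq:
  assumes \<phi>: "\<phi> \<in> nerve_cochains C n"
  shows "nerve_differential C n \<phi>
    = nerve_cochain_of C (Suc n) (\<lambda>x. \<Sum>i \<le> Suc n. (- 1) ^ i * \<phi> (basis (face C n i x)))"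
proof
  fix u
  show "nerve_differential C n \<phi> u
    = nerve_cochain_of C (Suc n) (\<lambda>x. \<Sum>i \<le> Suc n. (- 1) ^ i * \<phi> (basis (face C n i x))) u"
  proof (cases "u \<in> free_space (nerve C (Suc n))")
    case True
    have add: "\<phi> (v + w) = \<phi> v + \<phi> w"
      if "v \<in> free_space (nerve C n)" "w \<in> free_space (nerve C n)" for v w
      using \<phi> that by (simp add: nerve_cochains_def linear_between_def)
    have scale: "\<phi> (free_scale a v) = a * \<phi> v" if "v \<in> free_space (nerve C n)" for a v
      using \<phi> that by (simp add: nerve_cochains_def linear_between_def)
    have zero: "\<phi> 0 = 0"
      using scale [of 0 0] by simp
    have "\<phi> (free_map (face C n i) u)
        = (\<Sum>x \<in> Poly_Mapping.keys u. Poly_Mapping.lookup u x * \<phi> (basis (face C n i x)))"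
      if i: "i \<le> Suc n" for i
    proof -
      have face: "face C n i x \<in> nerve C n" if "x \<in> Poly_Mapping.keys u" for x
        using face_mem_nerve [OF _ i, of x] True that unfolding free_space_def by blast
      have single: "Poly_Mapping.single x a = free_scale a (basis x)"
        for x :: "'o list \<times> 'm list" and a :: 'a
        by (rule poly_mapping_eqI) (simp add: lookup_single when_def)
      have "\<phi> (\<Sum>x \<in> I. Poly_Mapping.single (face C n i x) (Poly_Mapping.lookup u x))
          = (\<Sum>x \<in> I. Poly_Mapping.lookup u x * \<phi> (basis (face C n i x)))"
        if "finite I" "I \<subseteq> Poly_Mapping.keys u" for I
        using that
      proof (induction I)
        case (insert x I)
        then have "(\<Sum>x \<in> I. Poly_Mapping.single (face C n i x) (Poly_Mapping.lookup u x))
            \<in> free_space (nerve C n)"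
          using face by (intro sum_mem_free_space) (auto simp: free_space_def)
        with insert show ?case
          using face single [of "face C n i x" "Poly_Mapping.lookup u x"]
          by (simp add: add scale free_scale_mem_free_space)
      qed (simp add: zero)
      then show ?thesis
        by (simp add: free_map_def)
    qed
    then have "nerve_differential C n \<phi> u = (\<Sum>i \<le> Suc n. (- 1) ^ i
        * (\<Sum>x \<in> Poly_Mapping.keys u. Poly_Mapping.lookup u x * \<phi> (basis (face C n i x))))"
      using True by (simp add: nerve_differential_def del: sum.atMost_Suc)
    also have "\<dots> = (\<Sum>x \<in> Poly_Mapping.keys u. Poly_Mapping.lookup u x
        * (\<Sum>i \<le> Suc n. (- 1) ^ i * \<phi> (basis (face C n i x))))"
      by (rule sum_mult_swap)
    finally show ?thesis
      using True by (simp add: nerve_cochain_of_def del: sum.atMost_Suc)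
  qed (simp add: nerve_differential_def nerve_cochain_of_def)
qed

section \<open>Chains of the adjoint category\<close>

text \<open>Hochschild tuples are read against the direction of composition, so the word of a chain
  \<open>a\<^sub>0 \<rightarrow> \<dots> \<rightarrow> a\<^sub>n\<close> with morphisms \<open>g\<^sub>0, \<dots>, g\<^sub>n\<^sub>-\<^sub>1\<close> is \<open>[g\<^sub>n\<^sub>-\<^sub>1, \<dots>, g\<^sub>0]\<close>; its value is
  \<open>g\<^sub>n\<^sub>-\<^sub>1 \<circ> \<dots> \<circ> g\<^sub>0 \<circ> a\<^sub>0 = a\<^sub>n \<circ> g\<^sub>n\<^sub>-\<^sub>1 \<circ> \<dots> \<circ> g\<^sub>0\<close>.\<close>

definition chain_word :: "'m list \<times> ('m \<times> 'm \<times> 'm) list \<Rightarrow> 'm list" where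
  "chain_word ch = rev (map (fst \<circ> snd) (snd ch))"

definition chain_value :: "('o, 'm) cat \<Rightarrow> 'm list \<times> ('m \<times> 'm \<times> 'm) list \<Rightarrow> 'm" where
  "chain_value C ch = foldr (Cmp C) (chain_word ch) (hd (fst ch))"

abbreviation trace :: "('o, 'm) cat \<Rightarrow> 'm list \<times> ('m \<times> 'm \<times> 'm) list \<Rightarrow> 'm list \<times> 'm" where
  "trace C ch \<equiv> (chain_word ch, chain_value C ch)"

text \<open>\<open>a\<close> is the initial endomorphism of a prospective chain with word
  \<open>gs\<close> and value \<open>h\<close>. The later endomorphisms are left out, as they are
  obtained by transport.\<close>

definition matched :: "('o, 'm) cat \<Rightarrow> 'm list \<Rightarrow> 'm \<Rightarrow> bool" where
  "matched C gs h \<longleftrightarrow> (\<exists>x y. \<exists>a \<in> End C x. is_path C y gs x \<and> h = foldr (Cmp C) gs a)"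

context category
begin

lemma is_path_Mor: "is_path C y gs x \<Longrightarrow> set gs \<subseteq> Mor C"
  by (induction gs arbitrary: y) auto

lemma is_path_Obj: "is_path C y gs x \<Longrightarrow> x \<in> Obj C \<and> y \<in> Obj C"
  by (induction gs arbitrary: y) (auto simp: Tgt_in_Obj)

lemma is_path_append:
  "is_path C z (gs @ hs) x \<longleftrightarrow> (\<exists>y. is_path C z gs y \<and> is_path C y hs x)"
  by (induction gs arbitrary: z) (auto dest: is_path_Obj)

lemma is_path_unique: "is_path C y gs x \<Longrightarrow> is_path C y' gs x \<Longrightarrow> y = y'"
  by (cases gs) auto

lemma foldr_Cmp_Hom:
  "is_path C y gs x \<Longrightarrow> a \<in> Hom C w x \<Longrightarrow> foldr (Cmp C) gs a \<in> Hom C w y"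
proof (induction gs arbitrary: y)
  case (Cons g gs)
  then show ?case
    using Cmp_in_Hom [of "foldr (Cmp C) gs a" w "Src C g" g y] by (auto simp: Hom_iff)
qed simp

lemma foldr_Cmp_Cmp:
  assumes "is_path C y gs x" "a \<in> Hom C w x" "g \<in> Hom C v w"
  shows "foldr (Cmp C) gs (Cmp C a g) = Cmp C (foldr (Cmp C) gs a) g"
  using assms(1)
proof (induction gs arbitrary: y)
  case (Cons k gs)
  then show ?case
    using Cmp_assoc [OF assms(3) foldr_Cmp_Hom [of "Src C k" gs x a w], of k y] assms(2)
    by (auto simp: Hom_iff)
qed simp

lemma
  assumes "Src C u = Tgt C v" "u \<in> Mor C" "v \<in> Mor C"
  shows is_path_merge: "is_path C y (p @ Cmp C u v # q) x \<longleftrightarrow> is_path C y (p @ u # v # q) x"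
    and foldr_Cmp_merge: "is_path C y (p @ u # v # q) x \<Longrightarrow> a \<in> Hom C w x \<Longrightarrow>
      foldr (Cmp C) (p @ Cmp C u v # q) a = foldr (Cmp C) (p @ u # v # q) a"
proof -
  show "is_path C y (p @ Cmp C u v # q) x \<longleftrightarrow> is_path C y (p @ u # v # q) x"
    using assms Cmp_in_Mor [of v u] Src_Cmp [of v u] Tgt_Cmp [of v u]
    by (auto simp: is_path_append)
next
  assume "is_path C y (p @ u # v # q) x" "a \<in> Hom C w x"
  then have "foldr (Cmp C) q a \<in> Hom C w (Src C v)"
    using foldr_Cmp_Hom by (auto simp: is_path_append)
  then show "foldr (Cmp C) (p @ Cmp C u v # q) a = foldr (Cmp C) (p @ u # v # q) a"
    using assms Cmp_assoc_Mor [of "foldr (Cmp C) q a" v u] by (simp add: Hom_iff)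
qed

lemma nerve_adjoint_0: "ch \<in> nerve (adjoint_category C) 0 \<longleftrightarrow>
    (\<exists>x \<in> Obj C. \<exists>a \<in> End C x. ch = ([a], []))"
  by (cases ch) (auto simp: nerve_def adjoint_category_def length_Suc_conv)

text \<open>Consecutive triples share an endomorphism, and an endomorphism determines its object;
  hence the underlying morphisms compose in \<open>C\<close>.\<close>

lemma nerve_adjoint_path:
  "ch \<in> nerve (adjoint_category C) m \<Longrightarrow>
    \<exists>x y. fst ch \<noteq> [] \<and> hd (fst ch) \<in> End C x \<and> last (fst ch) \<in> End C y
      \<and> is_path C y (chain_word ch) x \<and> length (chain_word ch) = m"
proof (induction m arbitrary: ch)
  case 0
  then show ?case
    by (auto simp: nerve_adjoint_0 chain_word_def)
next
  case (Suc m)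
  from Suc.prems obtain as ts b t where ch: "ch = (as @ [b], ts @ [t])"
    "(as, ts) \<in> nerve (adjoint_category C) m" "t \<in> Hom (adjoint_category C) (last as) b"
    by (rule nerve_Suc_cases)
  from Suc.IH [OF ch(2)] obtain x y where IH: "as \<noteq> []" "hd as \<in> End C x" "last as \<in> End C y"
      "is_path C y (chain_word (as, ts)) x" "length (chain_word (as, ts)) = m"
    by auto
  obtain y' z g where g: "g \<in> Hom C y' z" "last as \<in> End C y'" "b \<in> End C z" "t = (last as, g, b)"
    using ch(3) unfolding mem_Hom_adjoint_category by blast
  have "y' = y"
    using g(2) IH(3) by (simp add: Hom_iff)
  then have "is_path C z (g # chain_word (as, ts)) x"
    using g(1) IH(4) by (simp add: Hom_iff)
  then show ?case
    using IH g by (intro exI [of _ x] exI [of _ z]) (simp add: ch(1) chain_word_def)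
qed

lemma nerve_adjoint_trace:
  assumes "ch \<in> nerve (adjoint_category C) m"
  shows "matched C (chain_word ch) (chain_value C ch)"
    and "length (chain_word ch) = m" and "set (chain_word ch) \<subseteq> Mor C" and "chain_value C ch \<in> Mor C"
proof -
  obtain x y where ch: "hd (fst ch) \<in> End C x" "is_path C y (chain_word ch) x"
      "length (chain_word ch) = m"
    using nerve_adjoint_path [OF assms] by blast
  then show "matched C (chain_word ch) (chain_value C ch)" "length (chain_word ch) = m"
    by (auto simp: matched_def chain_value_def)
  show "set (chain_word ch) \<subseteq> Mor C"
    using ch(2) by (rule is_path_Mor)
  show "chain_value C ch \<in> Mor C"
    using foldr_Cmp_Hom [OF ch(2,1)] by (simp add: chain_value_def Hom_iff)
qed

text \<open>Dropping the end of a chain keeps the initial endomorphism and strips the outermost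
  factor from the value. This face corresponds to the outer left Hochschild term.\<close>

lemma face_last:
  assumes "ch \<in> nerve (adjoint_category C) (Suc m)"
  defines "ch' \<equiv> face (adjoint_category C) m (Suc m) ch"
  shows "chain_word ch' = tl (chain_word ch)"
    and "Src C (hd (chain_word ch)) = Tgt C (chain_value C ch')"
    and "Cmp C (hd (chain_word ch)) (chain_value C ch') = chain_value C ch"
proof -
  obtain as ts b t where ch: "ch = (as @ [b], ts @ [t])"
    "(as, ts) \<in> nerve (adjoint_category C) m" "t \<in> Hom (adjoint_category C) (last as) b"
    using assms(1) by (rule nerve_Suc_cases)
  obtain x y where xy: "as \<noteq> []" "hd as \<in> End C x" "last as \<in> End C y"
      "is_path C y (chain_word (as, ts)) x"
    using nerve_adjoint_path [OF ch(2)] by auto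
  obtain y' z g where g: "g \<in> Hom C y' z" "last as \<in> End C y'" "t = (last as, g, b)"
    using ch(3) unfolding mem_Hom_adjoint_category by blast
  have "ch' = (as, ts)"
    by (simp add: ch'_def ch(1) face_def)
  moreover have "chain_value C (as, ts) \<in> Hom C x y"
    using foldr_Cmp_Hom [OF xy(4,2)] by (simp add: chain_value_def)
  ultimately show "chain_word ch' = tl (chain_word ch)"
    "Src C (hd (chain_word ch)) = Tgt C (chain_value C ch')"
    "Cmp C (hd (chain_word ch)) (chain_value C ch') = chain_value C ch"
    using g xy by (simp_all add: ch(1) chain_word_def chain_value_def Hom_iff)
qed

text \<open>The initial endomorphism changes from \<open>a\<close> to \<open>b\<close>, and the
  square \<open>g \<circ> a = b \<circ> g\<close> brings \<open>g\<close> to the right of the new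
  value. This face corresponds to the outer right Hochschild term.\<close>

lemma face_first:
  assumes "ch \<in> nerve (adjoint_category C) (Suc m)"
  defines "ch' \<equiv> face (adjoint_category C) m 0 ch"
  shows "chain_word ch' = butlast (chain_word ch)"
    and "Src C (chain_value C ch') = Tgt C (last (chain_word ch))"
    and "Cmp C (chain_value C ch') (last (chain_word ch)) = chain_value C ch"
proof -
  obtain a b as t ts where ch: "ch = (a # b # as, t # ts)"
    using assms by (cases ch) (auto simp: nerve_def length_Suc_conv)
  have "t \<in> Hom (adjoint_category C) a b"
    using assms(1) unfolding ch nerve_def by fastforce
  then obtain x y g where g: "g \<in> Hom C x y" "a \<in> End C x" "b \<in> End C y" "Cmp C g a = Cmp C b g"
      "t = (a, g, b)"
    unfolding mem_Hom_adjoint_category by blast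
  obtain x' y' where "is_path C y' (chain_word ch) x'" "a \<in> End C x'"
    using nerve_adjoint_path [OF assms(1)] ch by auto
  then have path: "is_path C y' (chain_word (b # as, ts)) y"
    using g by (auto simp: ch chain_word_def is_path_append Hom_iff)
  have ch': "ch' = (b # as, ts)"
    by (simp add: ch'_def ch face_def)
  then show "chain_word ch' = butlast (chain_word ch)"
    by (simp add: ch chain_word_def)
  show "Src C (chain_value C ch') = Tgt C (last (chain_word ch))"
    using foldr_Cmp_Hom [OF path g(3)] g(1,5) by (simp add: ch' ch chain_word_def chain_value_def Hom_iff)
  show "Cmp C (chain_value C ch') (last (chain_word ch)) = chain_value C ch"
    using foldr_Cmp_Cmp [OF path g(3,1)] g(4,5)
    by (simp add: ch' ch chain_word_def chain_value_def)
qed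

text \<open>Words are reversed, so composing at the object with index \<open>Suc m - j\<close>
  multiplies the entries \<open>j - 1\<close> and \<open>j\<close>. The initial endomorphism and the
  composite of the path stay the same.\<close>

lemma face_middle:
  assumes ch: "ch \<in> nerve (adjoint_category C) (Suc m)" and j: "1 \<le> j" "j \<le> m"
  defines "gs \<equiv> chain_word ch"
  shows "chain_word (face (adjoint_category C) m (Suc m - j) ch)
      = take (j - 1) gs @ Cmp C (gs ! (j - 1)) (gs ! j) # drop (Suc j) gs"
    and "chain_value C (face (adjoint_category C) m (Suc m - j) ch) = chain_value C ch"
    and "Src C (gs ! (j - 1)) = Tgt C (gs ! j)"
proof -
  obtain as ts where as: "ch = (as, ts)" "length as = Suc (Suc m)" "length ts = Suc m"
    using ch by (auto simp: nerve_def)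
  obtain i where i: "j = Suc i" "i < m"
    using j by (cases j) auto
  have len: "length gs = Suc m"
    unfolding gs_def by (rule nerve_adjoint_trace [OF ch])
  have nth: "gs ! l = fst (snd (ts ! (m - l)))" if "l \<le> m" for l
    using that as by (simp add: gs_def chain_word_def rev_nth)
  obtain x y where path: "hd as \<in> End C x" "is_path C y gs x"
    using nerve_adjoint_path [OF ch] as by (auto simp: gs_def)
  have split: "gs = take i gs @ gs ! i # gs ! Suc i # drop (Suc (Suc i)) gs"
    using i len by (simp add: Cons_nth_drop_Suc)
  then have path': "is_path C y (take i gs @ gs ! i # gs ! Suc i # drop (Suc (Suc i)) gs) x"
    using path(2) by simp
  then have uv: "Src C (gs ! i) = Tgt C (gs ! Suc i)" "gs ! i \<in> Mor C" "gs ! Suc i \<in> Mor C"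
    by (auto simp: is_path_append)
  then show "Src C (gs ! (j - 1)) = Tgt C (gs ! j)"
    using i by simp
  have mid: "fst (snd (Cmp (adjoint_category C) u v)) = Cmp C (fst (snd u)) (fst (snd v))" for u v
    by (cases u; cases v) (simp add: adjoint_category_def)
  have "map (fst \<circ> snd) (take (m - i - 1) ts) = rev (drop (Suc (Suc i)) gs)"
    "map (fst \<circ> snd) (drop (Suc (m - i)) ts) = rev (take i gs)"
    using i as by (simp_all add: gs_def chain_word_def rev_drop rev_take take_map drop_map Suc_diff_le)
  moreover have "Suc m - j = m - i" "m - i \<noteq> 0" "m - i \<noteq> Suc m"
    using i by auto
  ultimately show word: "chain_word (face (adjoint_category C) m (Suc m - j) ch)
      = take (j - 1) gs @ Cmp C (gs ! (j - 1)) (gs ! j) # drop (Suc j) gs"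
    using i by (simp add: as(1) face_def chain_word_def mid nth)
  have "hd (fst (face (adjoint_category C) m (Suc m - j) ch)) = hd as"
    using i as by (cases as) (auto simp: face_def take_Cons split: nat.splits)
  then have "chain_value C (face (adjoint_category C) m (Suc m - j) ch)
      = foldr (Cmp C) (take i gs @ Cmp C (gs ! i) (gs ! Suc i) # drop (Suc (Suc i)) gs) (hd as)"
    unfolding chain_value_def word using i by simp
  also have "\<dots> = foldr (Cmp C) (take i gs @ gs ! i # gs ! Suc i # drop (Suc (Suc i)) gs) (hd as)"
    by (rule foldr_Cmp_merge [OF uv path' path(1)])
  also have "\<dots> = foldr (Cmp C) gs (hd as)"
    by (rule arg_cong [where f = "\<lambda>l. foldr (Cmp C) l (hd as)", OF split [symmetric]])
  finally show "chain_value C (face (adjoint_category C) m (Suc m - j) ch) = chain_value C ch"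
    using as by (simp add: chain_value_def gs_def)
qed

end

section \<open>Transport of endomorphisms and the correspondence between chains and matched
  pairs\<close>

locale deterministic_cancellative_category = finite_category C for C :: "('o, 'm) cat" +
  assumes deterministic: "deterministic C"
    and cancellative: "cancellative C"
begin

lemma right_det:
  assumes "g \<in> Hom C x y" "a \<in> End C x"
  obtains b where "b \<in> End C y" "Cmp C g a = Cmp C b g"
proof -
  have "x \<in> Obj C" "y \<in> Obj C"
    using assms(1) Src_in_Obj Tgt_in_Obj by (auto simp: Hom_iff)
  then show thesis
    using assms that deterministic unfolding deterministic_def right_deterministic_def by blast
qed

lemma left_det:
  assumes "g \<in> Hom C x y" "b \<in> End C y"
  obtains a where "a \<in> End C x" "Cmp C g a = Cmp C b g"
proof -
  have "x \<in> Obj C" "y \<in> Obj C"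
    using assms(1) Src_in_Obj Tgt_in_Obj by (auto simp: Hom_iff)
  then show thesis
    using assms that deterministic unfolding deterministic_def left_deterministic_def by blast
qed

lemma left_cancel:
  assumes "g \<in> Mor C" "f \<in> Mor C" "f' \<in> Mor C" "Src C g = Tgt C f" "Src C g = Tgt C f'"
    "Cmp C g f = Cmp C g f'"
  shows "f = f'"
proof -
  have "Src C f = Src C f'"
    using assms Src_Cmp by metis
  then have "f \<in> Hom C (Src C f) (Src C g)" "f' \<in> Hom C (Src C f) (Src C g)"
      "g \<in> Hom C (Src C g) (Tgt C g)"
    using assms by (simp_all add: Hom_iff)
  then show ?thesis
    using cancellative assms Src_in_Obj Tgt_in_Obj
    unfolding cancellative_def left_cancellative_def by blast
qed

lemma right_cancel:
  assumes "f \<in> Mor C" "g \<in> Mor C" "g' \<in> Mor C" "Src C g = Tgt C f" "Src C g' = Tgt C f"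
    "Cmp C g f = Cmp C g' f"
  shows "g = g'"
proof -
  have "Tgt C g = Tgt C g'"
    using assms Tgt_Cmp by metis
  then have "g \<in> Hom C (Tgt C f) (Tgt C g)" "g' \<in> Hom C (Tgt C f) (Tgt C g)"
      "f \<in> Hom C (Src C f) (Tgt C f)"
    using assms by (simp_all add: Hom_iff)
  then show ?thesis
    using cancellative assms Src_in_Obj Tgt_in_Obj
    unfolding cancellative_def right_cancellative_def by blast
qed

text \<open>A chain is recovered from its end. Left cancellation of the last morphism
  \<open>g\<close> yields the value of the truncated chain, and so that chain by induction; right
  cancellation in \<open>b \<circ> g = g \<circ> a\<close> yields the last endomorphism
  \<open>b\<close>.\<close>

lemma inj_on_trace: "inj_on (trace C) (nerve (adjoint_category C) m)"
proof (induction m)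
  case 0
  then show ?case
    by (auto simp: inj_on_def nerve_adjoint_0 chain_word_def chain_value_def)
next
  case (Suc m)
  show ?case
  proof (rule inj_onI)
    fix ch ch' assume *: "ch \<in> nerve (adjoint_category C) (Suc m)"
      "ch' \<in> nerve (adjoint_category C) (Suc m)" "trace C ch = trace C ch'"
    from *(1) obtain as ts b t where ch: "ch = (as @ [b], ts @ [t])"
      "(as, ts) \<in> nerve (adjoint_category C) m" "t \<in> Hom (adjoint_category C) (last as) b"
      by (rule nerve_Suc_cases)
    from *(2) obtain as' ts' b' t' where ch': "ch' = (as' @ [b'], ts' @ [t'])"
      "(as', ts') \<in> nerve (adjoint_category C) m" "t' \<in> Hom (adjoint_category C) (last as') b'"
      by (rule nerve_Suc_cases)
    obtain y z g where g: "g \<in> Hom C y z" "last as \<in> End C y" "b \<in> End C z"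
        "Cmp C g (last as) = Cmp C b g" "t = (last as, g, b)"
      using ch(3) unfolding mem_Hom_adjoint_category by blast
    obtain y' z' g' where g': "g' \<in> Hom C y' z'" "last as' \<in> End C y'" "b' \<in> End C z'"
        "Cmp C g' (last as') = Cmp C b' g'" "t' = (last as', g', b')"
      using ch'(3) unfolding mem_Hom_adjoint_category by blast
    have ne: "as \<noteq> []" "as' \<noteq> []"
      using ch(2) ch'(2) by (auto simp: nerve_def)
    then have eq: "g = g'" "chain_word (as, ts) = chain_word (as', ts')"
        "Cmp C g (chain_value C (as, ts)) = Cmp C g (chain_value C (as', ts'))"
      using *(3) by (auto simp: ch(1) ch'(1) chain_word_def chain_value_def g(5) g'(5))
    \<comment> \<open>The value of the truncated chain ends at the object of its last endomorphism,
      which is the source of \<open>g\<close>; cancellation needs this composability.\<close>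
    have val: "chain_value C (as, ts) \<in> Mor C \<and> Tgt C (chain_value C (as, ts)) = Src C g"
      if chain: "(as, ts) \<in> nerve (adjoint_category C) m" "last as \<in> End C (Src C g)" for as ts
    proof -
      obtain x y where xy: "hd as \<in> End C x" "last as \<in> End C y" "is_path C y (chain_word (as, ts)) x"
        using nerve_adjoint_path [OF chain(1)] by auto
      moreover have "y = Src C g"
        using xy(2) chain(2) by (simp add: Hom_iff)
      ultimately show ?thesis
        using foldr_Cmp_Hom [OF xy(3,1)] by (simp add: chain_value_def Hom_iff)
    qed
    have "chain_value C (as, ts) = chain_value C (as', ts')"
    proof (rule left_cancel)
      have "last as \<in> End C (Src C g)" "last as' \<in> End C (Src C g)"
        using g(1,2) g'(1,2) eq(1) by (simp_all add: Hom_iff)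
      then show "chain_value C (as, ts) \<in> Mor C" "chain_value C (as', ts') \<in> Mor C"
        "Src C g = Tgt C (chain_value C (as, ts))" "Src C g = Tgt C (chain_value C (as', ts'))"
        using val [OF ch(2)] val [OF ch'(2)] by simp_all
    qed (use g(1) eq(3) in \<open>simp_all add: Hom_iff\<close>)
    then have "(as, ts) = (as', ts')"
      using inj_onD [OF Suc.IH _ ch(2) ch'(2)] eq(2) by simp
    moreover have "b = b'"
    proof (rule right_cancel)
      show "Cmp C b g = Cmp C b' g"
        using g(4) g'(4) eq(1) calculation by simp
      show "g \<in> Mor C" "b \<in> Mor C" "b' \<in> Mor C" "Src C b = Tgt C g" "Src C b' = Tgt C g"
        using g(1,3) g'(1,3) eq(1) by (simp_all add: Hom_iff)
    qed
    ultimately show "ch = ch'"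
      using ch(1) ch'(1) g(5) g'(5) eq(1) by simp
  qed
qed

text \<open>Right determinism carries \<open>a\<close> along the path one morphism at a time, each
  time closing a commuting square.\<close>

lemma chain_of_path:
  assumes "is_path C y gs x" "a \<in> End C x"
  shows "\<exists>as ts. (as, ts) \<in> nerve (adjoint_category C) (length gs)
    \<and> chain_word (as, ts) = gs \<and> hd as = a"
  using assms
proof (induction gs arbitrary: y)
  case Nil
  then show ?case
    by (intro exI [of _ "[a]"] exI [of _ "[]"]) (auto simp: nerve_adjoint_0 chain_word_def)
next
  case (Cons g gs)
  then obtain as ts where as: "(as, ts) \<in> nerve (adjoint_category C) (length gs)"
      "chain_word (as, ts) = gs" "hd as = a"
    using Cons.IH [of "Src C g"] by auto
  obtain x' y' where xy: "as \<noteq> []" "hd as \<in> End C x'" "last as \<in> End C y'" "is_path C y' gs x'"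
    using nerve_adjoint_path [OF as(1)] as(2) by auto
  have "x' = x"
    using xy(2) as(3) Cons.prems(2) by (simp add: Hom_iff)
  then have "y' = Src C g"
    using xy(4) Cons.prems(1) is_path_unique by auto
  then have "g \<in> Hom C y' y"
    using Cons.prems(1) by (simp add: Hom_iff)
  then obtain b where b: "b \<in> End C y" "Cmp C g (last as) = Cmp C b g"
    using right_det [OF _ xy(3)] by metis
  have obj: "y \<in> Obj C" "y' \<in> Obj C"
    using is_path_Obj Cons.prems(1) xy(4) by blast+
  have "(as @ [b], ts @ [(last as, g, b)]) \<in> nerve (adjoint_category C) (Suc (length gs))"
    unfolding nerve_snoc mem_Hom_adjoint_category
    using as(1) b xy(3) obj \<open>g \<in> Hom C y' y\<close> by (auto simp: adjoint_category_def)
  then show ?case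
    using as xy(1) by (intro exI [of _ "as @ [b]"] exI [of _ "ts @ [(last as, g, b)]"])
      (auto simp: chain_word_def)
qed

lemma matched_iff:
  "matched C gs h \<longleftrightarrow> (gs, h) \<in> trace C ` nerve (adjoint_category C) (length gs)"
proof
  assume "matched C gs h"
  then obtain x y a where a: "is_path C y gs x" "a \<in> End C x" "h = foldr (Cmp C) gs a"
    by (auto simp: matched_def)
  then obtain as ts where "(as, ts) \<in> nerve (adjoint_category C) (length gs)"
      "chain_word (as, ts) = gs" "hd as = a"
    using chain_of_path by blast
  moreover from this a have "trace C (as, ts) = (gs, h)"
    by (simp add: chain_value_def)
  ultimately show "(gs, h) \<in> trace C ` nerve (adjoint_category C) (length gs)"
    by force
qed (auto dest: nerve_adjoint_trace(1))

lemma matched_Cons: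
  assumes "matched C gs h" "g \<in> Mor C" "h \<in> Mor C" "Src C g = Tgt C h"
  shows "matched C (g # gs) (Cmp C g h)"
proof -
  obtain x y a where a: "is_path C y gs x" "a \<in> End C x" "h = foldr (Cmp C) gs a"
    using assms(1) by (auto simp: matched_def)
  then have "is_path C (Tgt C g) (g # gs) x"
    using assms foldr_Cmp_Hom [OF a(1,2)] by (simp add: Hom_iff)
  with a show ?thesis
    unfolding matched_def by (intro exI [of _ x] exI [of _ "Tgt C g"] bexI [of _ a]) auto
qed

text \<open>From \<open>h = G \<circ> a\<close>, left determinism turns \<open>a \<circ> g\<close>
  into \<open>g \<circ> a'\<close>, which moves the initial endomorphism to the source of
  \<open>g\<close>.\<close>

lemma matched_snoc:
  assumes "matched C gs h" "g \<in> Mor C" "h \<in> Mor C" "Src C h = Tgt C g"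
  shows "matched C (gs @ [g]) (Cmp C h g)"
proof -
  obtain x y a where a: "is_path C y gs x" "a \<in> End C x" "h = foldr (Cmp C) gs a"
    using assms(1) by (auto simp: matched_def)
  then have "x = Tgt C g"
    using assms(4) foldr_Cmp_Hom [OF a(1,2)] by (simp add: Hom_iff)
  then have g: "g \<in> Hom C (Src C g) x"
    using assms(2) by (simp add: Hom_iff)
  then obtain a' where a': "a' \<in> End C (Src C g)" "Cmp C g a' = Cmp C a g"
    using a(2) left_det by blast
  have "is_path C y (gs @ [g]) (Src C g)"
    using a(1) assms(2) \<open>x = Tgt C g\<close> by (auto simp: is_path_append Src_in_Obj)
  moreover have "Cmp C h g = foldr (Cmp C) (gs @ [g]) a'"
    using foldr_Cmp_Cmp [OF a(1,2) g] a(3) a'(2) by simp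
  ultimately show ?thesis
    unfolding matched_def using a'(1) by blast
qed

lemma matched_merge:
  assumes "matched C (p @ Cmp C u v # q) h" "Src C u = Tgt C v" "u \<in> Mor C" "v \<in> Mor C"
  shows "matched C (p @ u # v # q) h"
proof -
  obtain x y a where a: "is_path C y (p @ Cmp C u v # q) x" "a \<in> End C x"
      "h = foldr (Cmp C) (p @ Cmp C u v # q) a"
    using assms(1) by (auto simp: matched_def)
  then have path: "is_path C y (p @ u # v # q) x"
    using is_path_merge [OF assms(2-4)] by blast
  then have "h = foldr (Cmp C) (p @ u # v # q) a"
    using foldr_Cmp_merge [OF assms(2-4) path a(2)] a(3) by simp
  then show ?thesis
    unfolding matched_def using path a(2) by blast
qed

text \<open>\<open>h\<close> and the composite \<open>G\<close> of the path lie in the same Hom set,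
  where rr-transitivity solves \<open>G \<circ> a = h\<close>. The other direction only reads off
  source and target.\<close>

lemma matched_iff_is_path:
  assumes "rr_transitive C" "h \<in> Mor C"
  shows "matched C gs h \<longleftrightarrow> is_path C (Tgt C h) gs (Src C h)"
proof
  assume "matched C gs h"
  then obtain x y a where a: "is_path C y gs x" "a \<in> End C x" "h = foldr (Cmp C) gs a"
    by (auto simp: matched_def)
  then show "is_path C (Tgt C h) gs (Src C h)"
    using foldr_Cmp_Hom [OF a(1,2)] by (simp add: Hom_iff)
next
  assume path: "is_path C (Tgt C h) gs (Src C h)"
  define G where "G = foldr (Cmp C) gs (Idm C (Src C h))"
  have obj: "Src C h \<in> Obj C" "Tgt C h \<in> Obj C"
    using assms(2) Src_in_Obj Tgt_in_Obj by auto
  have "G \<in> Hom C (Src C h) (Tgt C h)" "h \<in> Hom C (Src C h) (Tgt C h)"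
    unfolding G_def using foldr_Cmp_Hom [OF path] Idm_in_End obj assms(2) by (auto simp: Hom_iff)
  then obtain a where a: "a \<in> End C (Src C h)" "Cmp C G a = h"
    using assms(1) obj unfolding rr_transitive_def by blast
  have "foldr (Cmp C) gs a = h"
    using foldr_Cmp_Cmp [OF path Idm_in_End [OF obj(1)] a(1)] a Cmp_Idm_left [OF a(1)]
    by (simp add: G_def)
  then show "matched C gs h"
    unfolding matched_def using path a(1) by blast
qed

end

section \<open>The comparison map\<close>

text \<open>The outer terms of the two differentials correspond with the roles of first and last face
  exchanged; these signs compensate for it.\<close>

definition reversal_sign :: "nat \<Rightarrow> 'k::field" where
  "reversal_sign n = (\<Prod>i\<le>n. (- 1) ^ i)"

lemma reversal_sign_Suc: "reversal_sign (Suc n) = (- 1) ^ Suc n * reversal_sign n"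
  by (simp add: reversal_sign_def)

lemma reversal_sign_square: "reversal_sign n * reversal_sign n = 1"
  by (induction n) (simp_all add: reversal_sign_def algebra_simps flip: power_add mult_2)

lemma reversal_sign_nonzero: "reversal_sign n \<noteq> (0 :: 'k::field)"
  using reversal_sign_square [of n, where ?'a = 'k] by auto

lemma coeff_zero: "coeff 0 gs h = 0"
  by (simp add: coeff_def)

definition comparison :: "('o, 'm) cat \<Rightarrow> nat \<Rightarrow> (('m \<Rightarrow>\<^sub>0 'k::field) list \<Rightarrow> ('m \<Rightarrow>\<^sub>0 'k))
    \<Rightarrow> (('m list \<times> ('m \<times> 'm \<times> 'm) list \<Rightarrow>\<^sub>0 'k) \<Rightarrow> 'k)" where
  "comparison C n f = nerve_cochain_of (adjoint_category C) n
    (\<lambda>ch. reversal_sign n * coeff f (chain_word ch) (chain_value C ch))"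

lemma linear_comparison:
  "Vector_Spaces.linear (\<lambda>c f as. ascale (category_algebra C) c (f as)) (\<lambda>c f u. c * f u)
    (comparison C n :: (('m \<Rightarrow>\<^sub>0 'k::field) list \<Rightarrow> _) \<Rightarrow> _)"
proof -
  interpret vs1: vector_space "\<lambda>c (f :: ('m \<Rightarrow>\<^sub>0 'k) list \<Rightarrow> 'm \<Rightarrow>\<^sub>0 'k) as. free_scale c (f as)"
    by (rule vector_space_free_scale_pointwise)
  interpret vs2: vector_space
    "\<lambda>c (f :: ('m list \<times> ('m \<times> 'm \<times> 'm) list \<Rightarrow>\<^sub>0 'k) \<Rightarrow> 'k) u. c * f u"
    by (rule vector_space_times_pointwise)
  show ?thesis
    unfolding category_algebra_simps
    by unfold_locales
      (auto simp: fun_eq_iff comparison_def nerve_cochain_of_def coeff_def lookup_add sum.distrib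
        sum_distrib_left algebra_simps)
qed

text \<open>\<open>cochain_of\<close> reproduces a table only at words of morphisms of the right
  length. The differential at a word of morphisms evaluates the table nowhere else.\<close>

lemma coeff_differential_cong:
  assumes gs: "length gs = Suc n" "set gs \<subseteq> Mor C" and h: "h \<in> Mor C" and "category C"
    and eq: "\<And>gs h. length gs = n \<Longrightarrow> set gs \<subseteq> Mor C \<Longrightarrow> h \<in> Mor C \<Longrightarrow> c gs h = c' gs h"
  shows "coeff_differential C c gs h = coeff_differential C c' gs h"
proof -
  interpret category C by fact
  have "gs \<noteq> []"
    using gs(1) by auto
  then have "set (tl gs) \<subseteq> Mor C" "set (butlast gs) \<subseteq> Mor C"
    using gs(2) in_set_butlastD [of _ gs] list.set_sel(2) [of gs] by blast+
  then have "left_sum C c gs h = left_sum C c' gs h" "right_sum C c gs h = right_sum C c' gs h"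
    unfolding left_sum_def right_sum_def using gs(1) by (auto intro!: sum.cong eq)
  moreover have "merge_sum C (\<lambda>l. c l h) gs = merge_sum C (\<lambda>l. c' l h) gs"
    unfolding merge_sum_eq_sum [OF gs(1)]
  proof (intro sum.cong refl arg_cong2 [where f = "(*)"] if_cong eq h)
    fix i assume i: "i \<in> {1..n}" "Src C (gs ! (i - 1)) = Tgt C (gs ! i)"
    then have "gs ! (i - 1) \<in> Mor C" "gs ! i \<in> Mor C"
      using gs by auto
    then show "set (take (i - 1) gs @ Cmp C (gs ! (i - 1)) (gs ! i) # drop (Suc i) gs) \<subseteq> Mor C"
      using i gs(2) Cmp_in_Mor set_take_subset [of "i - 1" gs] set_drop_subset [of "Suc i" gs] by auto
    show "length (take (i - 1) gs @ Cmp C (gs ! (i - 1)) (gs ! i) # drop (Suc i) gs) = n"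
      using i(1) gs(1) by auto
  qed
  ultimately show ?thesis
    by (simp add: coeff_differential_def)
qed

section \<open>The comparison map commutes with the differentials\<close>

context deterministic_cancellative_category
begin

abbreviation Fad :: "('m, 'm \<times> 'm \<times> 'm) cat" where
  "Fad \<equiv> adjoint_category C"

lemma category_Fad: "category Fad"
  by (rule category_adjoint_category) unfold_locales

text \<open>By cancellation each sum over factorisations has one term, supplied by an outer face.
  The Hochschild terms are then precisely the faces in reverse order.\<close>

lemma coeff_differential_trace:
  fixes c :: "'m list \<Rightarrow> 'm \<Rightarrow> 'k::field"
  assumes ch: "ch \<in> nerve Fad (Suc n)"
  shows "reversal_sign (Suc n) * coeff_differential C c (chain_word ch) (chain_value C ch)
    = (\<Sum>i \<le> Suc n. (- 1) ^ i * (reversal_sign n *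
        c (chain_word (face Fad n i ch)) (chain_value C (face Fad n i ch))))"
proof -
  let ?gs = "chain_word ch" and ?h = "chain_value C ch"
  define w v where "w i = chain_word (face Fad n i ch)" and "v i = chain_value C (face Fad n i ch)" for i
  have len: "length ?gs = Suc n" and gs: "set ?gs \<subseteq> Mor C"
    using nerve_adjoint_trace [OF ch] by auto
  have ne: "?gs \<noteq> []"
    using len by auto
  have face: "v i \<in> Mor C \<and> matched C (w i) (v i)" if "i \<le> Suc n" for i
    using nerve_adjoint_trace [OF category.face_mem_nerve [OF category_Fad ch that]]
    by (simp add: v_def w_def)
  have hd: "hd ?gs \<in> Mor C" and last: "last ?gs \<in> Mor C"
    using gs ne by (auto simp: subset_iff)
  \<comment> \<open>The last face solves the factorisation equation, and left cancellation excludes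
    any other solution.\<close>
  have "{h'. h' \<in> Mor C \<and> Src C (hd ?gs) = Tgt C h' \<and> Cmp C (hd ?gs) h' = ?h} = {v (Suc n)}"
    using face_last(2,3) [OF ch] face [of "Suc n"] left_cancel [OF hd, of _ "v (Suc n)"]
    by (auto simp: v_def)
  then have left: "left_sum C c ?gs ?h = c (w (Suc n)) (v (Suc n))"
    using face_last(1) [OF ch] by (simp add: left_sum_def w_def)
  have "{h'. h' \<in> Mor C \<and> Src C h' = Tgt C (last ?gs) \<and> Cmp C h' (last ?gs) = ?h} = {v 0}"
    using face_first(2,3) [OF ch] face [of 0] right_cancel [OF last, of _ "v 0"]
    by (auto simp: v_def)
  then have right: "right_sum C c ?gs ?h = c (w 0) (v 0)"
    using face_first(1) [OF ch] by (simp add: right_sum_def w_def)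
  have "merge_sum C (\<lambda>l. c l ?h) ?gs = (\<Sum>j = 1..n. (- 1) ^ j * c (w (Suc n - j)) (v (Suc n - j)))"
    unfolding merge_sum_eq_sum [OF len] w_def v_def
    by (intro sum.cong refl) (simp add: face_middle [OF ch, simplified])
  \<comment> \<open>The substitution \<open>i = Suc n - j\<close> lists the faces in the order of
    the nerve.\<close>
  also have "\<dots> = (\<Sum>i = 1..n. (- 1) ^ (Suc n - i) * c (w i) (v i))"
    by (subst sum.atLeastAtMost_rev) (auto intro!: sum.cong)
  finally have middle: "merge_sum C (\<lambda>l. c l ?h) ?gs = (\<Sum>i = 1..n. (- 1) ^ (Suc n - i) * c (w i) (v i))" .
  have "coeff_differential C c ?gs ?h = (\<Sum>i \<le> Suc n. (- 1) ^ (Suc n - i) * c (w i) (v i))"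
    unfolding coeff_differential_def left middle right len
    by (simp add: sum.atMost_shift sum.atLeast1_atMost_eq)
  also have "(- 1) ^ Suc n * \<dots> = (\<Sum>i \<le> Suc n. (- 1) ^ i * c (w i) (v i))"
    unfolding sum_distrib_left
  proof (intro sum.cong refl)
    fix i assume "i \<in> {..Suc n}"
    \<comment> \<open>Multiplying by \<open>(-1)^(n+1)\<close> turns the exponent
      \<open>n + 1 - i\<close> into \<open>i\<close> up to an even number.\<close>
    then have "Suc n + (Suc n - i) = i + 2 * (Suc n - i)"
      by simp
    then have "(- 1) ^ Suc n * (- 1) ^ (Suc n - i) = (- 1 :: 'k) ^ i"
      by (metis mult.right_neutral power_add power_minus1_even)
    then show "(- 1) ^ Suc n * ((- 1) ^ (Suc n - i) * c (w i) (v i)) = (- 1) ^ i * c (w i) (v i)"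
      by (metis mult.assoc)
  qed
  finally show ?thesis
    by (simp only: reversal_sign_Suc w_def [symmetric] v_def [symmetric] mult.assoc
        mult.left_commute [of _ "reversal_sign n"] sum_distrib_left [symmetric])
qed

lemma comparison_basis:
  "ch \<in> nerve Fad n \<Longrightarrow>
    comparison C n f (basis ch) = reversal_sign n * coeff f (chain_word ch) (chain_value C ch)"
  by (simp add: comparison_def nerve_cochain_of_basis)

lemma comparison_mem: "comparison C n f \<in> nerve_cochains Fad n"
  unfolding comparison_def by (rule nerve_cochain_of_mem)

lemma comparison_differential:
  assumes f: "f \<in> hh_cochains C n"
  shows "comparison C (Suc n) (hh_differential C n f) = nerve_differential Fad n (comparison C n f)"
  unfolding category.nerve_differential_eq [OF category_Fad comparison_mem] comparison_def [of C "Suc n"]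
proof (rule nerve_cochain_of_cong)
  fix ch assume ch: "ch \<in> nerve Fad (Suc n)"
  then have "coeff (hh_differential C n f) (chain_word ch) (chain_value C ch)
      = coeff_differential C (coeff f) (chain_word ch) (chain_value C ch)"
    using coeff_hh_differential [OF f] nerve_adjoint_trace [OF ch] by blast
  then show "reversal_sign (Suc n) * coeff (hh_differential C n f) (chain_word ch) (chain_value C ch)
      = (\<Sum>i \<le> Suc n. (- 1) ^ i * comparison C n f (basis (face Fad n i ch)))"
    using category.face_mem_nerve [OF category_Fad ch]
    by (simp add: coeff_differential_trace [OF ch] comparison_basis del: sum.atMost_Suc cong: sum.cong_simp)
qed

section \<open>Extension by zero as a right inverse\<close>

text \<open>Injectivity of \<open>trace\<close> makes the chain behind a matched pair well defined.
  The sign is its own inverse and hence appears unchanged.\<close>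

definition section_coeff ::
  "nat \<Rightarrow> (('m list \<times> ('m \<times> 'm \<times> 'm) list \<Rightarrow>\<^sub>0 'k::field) \<Rightarrow> 'k) \<Rightarrow> 'm list \<Rightarrow> 'm \<Rightarrow> 'k" where
  "section_coeff n \<phi> gs h = (if matched C gs h
    then reversal_sign n * \<phi> (basis (the_inv_into (nerve Fad n) (trace C) (gs, h))) else 0)"

lemma section_coeff_trace:
  assumes "ch \<in> nerve Fad n"
  shows "section_coeff n \<phi> (chain_word ch) (chain_value C ch) = reversal_sign n * \<phi> (basis ch)"
  using the_inv_into_f_f [OF inj_on_trace assms] nerve_adjoint_trace(1) [OF assms]
  by (simp add: section_coeff_def)

lemma comparison_section:
  assumes "\<phi> \<in> nerve_cochains Fad n"
  shows "comparison C n (cochain_of C n (section_coeff n \<phi>)) = \<phi>"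
proof -
  have "comparison C n (cochain_of C n (section_coeff n \<phi>)) = nerve_cochain_of Fad n (\<lambda>ch. \<phi> (basis ch))"
    unfolding comparison_def
  proof (rule nerve_cochain_of_cong)
    fix ch assume ch: "ch \<in> nerve Fad n"
    have "coeff (cochain_of C n (section_coeff n \<phi>)) (chain_word ch) (chain_value C ch)
        = section_coeff n \<phi> (chain_word ch) (chain_value C ch)"
      using nerve_adjoint_trace [OF ch] by (intro coeff_cochain_of)
    then show "reversal_sign n * coeff (cochain_of C n (section_coeff n \<phi>)) (chain_word ch) (chain_value C ch)
        = \<phi> (basis ch)"
      by (simp add: section_coeff_trace [OF ch] reversal_sign_square mult.assoc [symmetric])
  qed
  then show ?thesis
    using nerve_cochain_of_values [OF assms] by simp
qed

text \<open>If any pair at which the differential evaluates the table were matched, then so would be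
  \<open>(gs, h)\<close>, by closure of matched pairs under multiplication on either side and under
  splitting an entry.\<close>

lemma coeff_differential_section_unmatched:
  assumes gs: "length gs = Suc n" "set gs \<subseteq> Mor C" and not: "\<not> matched C gs h"
  shows "coeff_differential C (section_coeff n \<phi>) gs h = 0"
proof -
  have ne: "gs \<noteq> []"
    using gs(1) by auto
  then have Mor: "hd gs \<in> Mor C" "last gs \<in> Mor C"
    using gs(2) by auto
  have "\<not> matched C (tl gs) h'" if "h' \<in> Mor C" "Src C (hd gs) = Tgt C h'" "Cmp C (hd gs) h' = h" for h'
    using matched_Cons [of "tl gs" h' "hd gs"] that Mor ne not by auto
  then have "left_sum C (section_coeff n \<phi>) gs h = 0"
    by (auto simp: left_sum_def section_coeff_def intro!: sum.neutral)
  moreover have "\<not> matched C (butlast gs) h'"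
    if "h' \<in> Mor C" "Src C h' = Tgt C (last gs)" "Cmp C h' (last gs) = h" for h'
    using matched_snoc [of "butlast gs" h' "last gs"] that Mor ne not by auto
  then have "right_sum C (section_coeff n \<phi>) gs h = 0"
    by (auto simp: right_sum_def section_coeff_def intro!: sum.neutral)
  moreover have "\<not> matched C (take (i - 1) gs @ Cmp C (gs ! (i - 1)) (gs ! i) # drop (Suc i) gs) h"
    if "i \<in> {1..n}" "Src C (gs ! (i - 1)) = Tgt C (gs ! i)" for i
  proof
    assume "matched C (take (i - 1) gs @ Cmp C (gs ! (i - 1)) (gs ! i) # drop (Suc i) gs) h"
    moreover have "gs ! (i - 1) \<in> Mor C" "gs ! i \<in> Mor C"
      using gs that by auto
    ultimately have "matched C (take (i - 1) gs @ gs ! (i - 1) # gs ! i # drop (Suc i) gs) h"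
      using that(2) by (intro matched_merge)
    moreover have "take (i - 1) gs @ gs ! (i - 1) # gs ! i # drop (Suc i) gs = gs"
      using that(1) gs(1) Cons_nth_drop_Suc [of i gs] Cons_nth_drop_Suc [of "i - 1" gs] by auto
    ultimately show False
      using not by simp
  qed
  then have "merge_sum C (\<lambda>l. section_coeff n \<phi> l h) gs = 0"
    unfolding merge_sum_eq_sum [OF gs(1)] by (auto simp: section_coeff_def intro!: sum.neutral)
  ultimately show ?thesis
    by (simp add: coeff_differential_def)
qed

text \<open>This makes extension by zero a chain map. At a matched pair the Hochschild terms are the
  faces of one chain; elsewhere both sides vanish.\<close>

lemma coeff_hh_differential_section:
  assumes \<phi>: "\<phi> \<in> nerve_cochains Fad n" and gs: "length gs = Suc n" "set gs \<subseteq> Mor C" and h: "h \<in> Mor C"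
  shows "coeff (hh_differential C n (cochain_of C n (section_coeff n \<phi>))) gs h
    = section_coeff (Suc n) (nerve_differential Fad n \<phi>) gs h"
proof -
  have D: "coeff (hh_differential C n (cochain_of C n (section_coeff n \<phi>))) gs h
      = coeff_differential C (section_coeff n \<phi>) gs h"
    unfolding coeff_hh_differential [OF cochain_of_mem gs]
    by (rule coeff_differential_cong [OF gs h category_axioms]) (rule coeff_cochain_of)
  show ?thesis
  proof (cases "matched C gs h")
    case True
    then obtain ch where ch: "ch \<in> nerve Fad (Suc n)" "chain_word ch = gs" "chain_value C ch = h"
      using gs(1) by (auto simp: matched_iff)
    have "reversal_sign (Suc n) * coeff_differential C (section_coeff n \<phi>) gs h
        = (\<Sum>i \<le> Suc n. (- 1) ^ i * (reversal_sign n * (reversal_sign n * \<phi> (basis (face Fad n i ch)))))"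
      unfolding coeff_differential_trace [OF ch(1), unfolded ch(2,3)]
      using category.face_mem_nerve [OF category_Fad ch(1)] by (intro sum.cong) (auto simp: section_coeff_trace)
    also have "\<dots> = nerve_differential Fad n \<phi> (basis ch)"
      unfolding category.nerve_differential_eq [OF category_Fad \<phi>] nerve_cochain_of_basis [OF ch(1)]
      by (simp add: mult.assoc [symmetric] reversal_sign_square del: sum.atMost_Suc)
    finally have "coeff_differential C (section_coeff n \<phi>) gs h
        = reversal_sign (Suc n) * nerve_differential Fad n \<phi> (basis ch)"
      by (metis mult.assoc mult_1 reversal_sign_square)
    then show ?thesis
      using D section_coeff_trace [OF ch(1), of "nerve_differential Fad n \<phi>"] ch(2,3) by simp
  next
    case False
    then show ?thesis
      using D coeff_differential_section_unmatched [OF gs False] by (simp add: section_coeff_def)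
  qed
qed

lemma cocycles_subset_comparison_image:
  "cocycles (nerve_cochains Fad) (nerve_differential Fad) n
    \<subseteq> comparison C n ` cocycles (hh_cochains C) (hh_differential C) n"
proof
  fix \<phi> :: "('m list \<times> ('m \<times> 'm \<times> 'm) list \<Rightarrow>\<^sub>0 'k::field) \<Rightarrow> 'k"
  assume "\<phi> \<in> cocycles (nerve_cochains Fad) (nerve_differential Fad) n"
  then have \<phi>: "\<phi> \<in> nerve_cochains Fad n" "nerve_differential Fad n \<phi> = 0"
    by (auto simp: cocycles_def)
  let ?f = "cochain_of C n (section_coeff n \<phi>)"
  \<comment> \<open>Its coefficients are those of the section of
    \<open>nerve_differential Fad n \<phi>\<close>, which is 0.\<close>
  have "hh_differential C n ?f = 0"
    using hh_differential_mem [OF cochain_of_mem] hh_cochains_zero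
    by (intro hh_cochains_eqI_coeff) (auto simp: coeff_hh_differential_section \<phi> section_coeff_def coeff_zero)
  then have "?f \<in> cocycles (hh_cochains C) (hh_differential C) n"
    by (simp add: cocycles_def cochain_of_mem)
  then show "\<phi> \<in> comparison C n ` cocycles (hh_cochains C) (hh_differential C) n"
    using comparison_section [OF \<phi>(1)] by (metis imageI)
qed

section \<open>Injectivity on cohomology in the rr-transitive case\<close>

text \<open>The matched and the unmatched part of \<open>f\<close> are coboundaries separately. The
  homotopy provides a primitive of the unmatched part. The matched part is the section of
  \<open>comparison C n f\<close>, so the section of \<open>\<psi>\<close> is a primitive of
  it.\<close>

lemma comparison_coboundary_imp_coboundary:
  fixes f :: "('m \<Rightarrow>\<^sub>0 'k::field) list \<Rightarrow> ('m \<Rightarrow>\<^sub>0 'k)"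
  assumes rr: "rr_transitive C"
    and f: "f \<in> cocycles (hh_cochains C) (hh_differential C) n"
    and Tf: "comparison C n f \<in> coboundaries (nerve_cochains Fad) (nerve_differential Fad) n"
  shows "f \<in> coboundaries (hh_cochains C) (hh_differential C) n"
proof -
  have f': "f \<in> hh_cochains C n" "hh_differential C n f = 0"
    using f by (auto simp: cocycles_def)
  \<comment> \<open>As \<open>f\<close> is a cocycle, only one composite of the homotopy identity
    survives. For the empty word that one is absent too, so unmatched coefficients in degree 0
    vanish.\<close>
  have homotopy: "(if gs = [] then 0 else coeff_differential C (gap_homotopy C (coeff f)) gs h)
      = (if matched C gs h then 0 else coeff f gs h)"
    if "length gs = n" "set gs \<subseteq> Mor C" "h \<in> Mor C" for gs h
  proof -
    have "gap_homotopy C (coeff_differential C (coeff f)) gs h = gap C (Src C h) (\<lambda>l. 0) (Tgt C h) gs"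
      unfolding gap_homotopy_def
    proof (rule gap_cong_Mor)
      fix l :: "'m list" assume "length l = Suc (length gs)" "set l \<subseteq> Mor C"
      then show "coeff_differential C (coeff f) l h = 0"
        using coeff_hh_differential [OF f'(1), of l h] f'(2) that(1) by (simp add: coeff_def)
    qed (use that Tgt_in_Obj in auto)
    then show ?thesis
      using gap_homotopy_identity [OF that(3,2), of "coeff f"] matched_iff_is_path [OF rr that(3)]
      by (simp add: gap_zero)
  qed
  show ?thesis
  proof (cases n)
    \<comment> \<open>Coboundaries in degree 0 are zero, so the claim is \<open>f = 0\<close>:
      matched coefficients vanish with \<open>comparison C n f\<close>, the others by the
      homotopy.\<close>
    case 0
    have "f = 0"
    proof (rule hh_cochains_eqI_coeff [OF f'(1) hh_cochains_zero])
      fix gs h assume gs: "length gs = n" "set gs \<subseteq> Mor C" "h \<in> Mor C"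
      have "coeff f gs h = 0"
      proof (cases "matched C gs h")
        case True
        then obtain ch where ch: "ch \<in> nerve Fad n" "chain_word ch = gs" "chain_value C ch = h"
          using gs(1) by (auto simp: matched_iff)
        have "comparison C n f (basis ch) = 0"
          using Tf 0 by simp
        then show ?thesis
          using comparison_basis [OF ch(1), of f] ch(2,3) by (simp add: reversal_sign_nonzero)
      qed (use homotopy [OF gs] gs 0 in simp)
      then show "coeff f gs h = coeff 0 gs h"
        by (simp add: coeff_zero)
    qed
    with 0 show ?thesis
      by simp
  next
    case (Suc m)
    obtain \<psi> where \<psi>: "\<psi> \<in> nerve_cochains Fad m" "comparison C n f = nerve_differential Fad m \<psi>"
      using Tf Suc by auto
    let ?u = "cochain_of C m (gap_homotopy C (coeff f))" and ?v = "cochain_of C m (section_coeff m \<psi>)"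
    have uv: "?u + ?v \<in> hh_cochains C m"
      using hh_cochains_add [OF cochain_of_mem cochain_of_mem] .
    have "f = hh_differential C m (?u + ?v)"
    proof (rule hh_cochains_eqI_coeff [OF f'(1)])
      show "hh_differential C m (?u + ?v) \<in> hh_cochains C n"
        using hh_differential_mem [OF uv] Suc by simp
      fix gs h assume gs: "length gs = n" "set gs \<subseteq> Mor C" "h \<in> Mor C"
      then have len: "length gs = Suc m" "gs \<noteq> []"
        using Suc by auto
      have "hh_differential C m (?u + ?v) = hh_differential C m ?u + hh_differential C m ?v"
        by (rule module_hom.add [OF linear.axioms(3) [OF linear_hh_differential]])
      moreover have "coeff (hh_differential C m ?u) gs h = (if matched C gs h then 0 else coeff f gs h)"
        using homotopy [OF gs] len
        unfolding coeff_hh_differential [OF cochain_of_mem len(1) gs(2)]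
        by (simp add: coeff_differential_cong [OF len(1) gs(2,3) category_axioms coeff_cochain_of])
      moreover have "coeff (hh_differential C m ?v) gs h = (if matched C gs h then coeff f gs h else 0)"
      proof (cases "matched C gs h")
        case True
        then obtain ch where ch: "ch \<in> nerve Fad n" "chain_word ch = gs" "chain_value C ch = h"
          using gs(1) by (auto simp: matched_iff)
        have "coeff (hh_differential C m ?v) gs h = section_coeff n (comparison C n f) gs h"
          using coeff_hh_differential_section [OF \<psi>(1) len(1) gs(2,3)] \<psi>(2) Suc by simp
        then show ?thesis
          using True section_coeff_trace [OF ch(1), of "comparison C n f"] ch(2,3)
          by (simp add: comparison_basis [OF ch(1)] mult.assoc [symmetric] reversal_sign_square)
      qed (use coeff_hh_differential_section [OF \<psi>(1) len(1) gs(2,3)] in \<open>simp add: section_coeff_def\<close>)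
      ultimately show "coeff f gs h = coeff (hh_differential C m (?u + ?v)) gs h"
        by (simp add: coeff_add)
    qed
    with uv Suc show ?thesis
      by auto
  qed
qed

end

theorem theorem1:
  fixes C :: "('o, 'm) cat"
  assumes "finite_category C"
    and "deterministic C"
    and "cancellative C"
  shows "\<exists>T :: nat \<Rightarrow> (('m \<Rightarrow>\<^sub>0 'k::field) list \<Rightarrow> ('m \<Rightarrow>\<^sub>0 'k)) set
                  \<Rightarrow> (('m list \<times> ('m \<times> 'm \<times> 'm) list \<Rightarrow>\<^sub>0 'k) \<Rightarrow> 'k) set.
    (\<forall>n. vlinear (hochschild_cohomology (category_algebra C) n)
                 (nerve_cohomology (adjoint_category C) n) (T n)) \<and>
    (\<forall>n. T n ` vcarrier (hochschild_cohomology (category_algebra C) n)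
           = vcarrier (nerve_cohomology (adjoint_category C) n)) \<and>
    (rr_transitive C \<longrightarrow>
      (\<forall>n. bij_betw (T n) (vcarrier (hochschild_cohomology (category_algebra C) n))
                          (vcarrier (nerve_cohomology (adjoint_category C) n))))"
proof -
  interpret deterministic_cancellative_category C
    using assms by (intro deterministic_cancellative_category.intro
        deterministic_cancellative_category_axioms.intro)
  let ?T = "\<lambda>n. induced_map (comparison C n :: (('m \<Rightarrow>\<^sub>0 'k) list \<Rightarrow> ('m \<Rightarrow>\<^sub>0 'k)) \<Rightarrow> _)
    (coboundaries (nerve_cochains Fad) (nerve_differential Fad) n)"
  let ?Z = "hh_cochains C :: nat \<Rightarrow> (('m \<Rightarrow>\<^sub>0 'k) list \<Rightarrow> ('m \<Rightarrow>\<^sub>0 'k)) set"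
    and ?s = "\<lambda>c (f :: ('m \<Rightarrow>\<^sub>0 'k) list \<Rightarrow> ('m \<Rightarrow>\<^sub>0 'k)) as. ascale (category_algebra C) c (f as)"
    and ?s' = "\<lambda>c (f :: ('m list \<times> ('m \<times> 'm \<times> 'm) list \<Rightarrow>\<^sub>0 'k) \<Rightarrow> 'k) u. c * f u"
  note chain_map = linear_hh_differential linear_nerve_differential subspace_hh_cochains
    subspace_nerve_cochains linear_comparison comparison_mem comparison_differential
  have "vlinear (cohomology ?s ?Z (hh_differential C) n)
      (cohomology ?s' (nerve_cochains Fad) (nerve_differential Fad) n) (?T n)" for n
    by (rule vlinear_cohomology_map) (rule chain_map; assumption?)+
  moreover have surj: "?T n ` vcarrier (cohomology ?s ?Z (hh_differential C) n)
      = vcarrier (cohomology ?s' (nerve_cochains Fad) (nerve_differential Fad) n)" for n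
    by (rule cohomology_map_surj) (rule chain_map cocycles_subset_comparison_image; assumption?)+
  moreover have "inj_on (?T n) (vcarrier (cohomology ?s ?Z (hh_differential C) n))"
    if "rr_transitive C" for n
    by (rule cohomology_map_inj)
       (rule chain_map comparison_coboundary_imp_coboundary [OF that]; assumption?)+
  ultimately show ?thesis
    unfolding hochschild_cohomology_def nerve_cohomology_def
    by (intro exI [of _ ?T] conjI allI impI bij_betw_imageI) simp_all
qed

end
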